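(* Let $K$ be an algebraically closed field (of any characteristic), let $n\geq 5$ be odd, and let $I\subset K[\mathbf{P}^2]$ be the radical ideal of $n$ distinct points on a smooth plane conic. Let $M\subset K[\mathbf{P}^2]$ be the ideal generated by the variables. Then: (i) $I^{(2r)}\subseteq M^{r}I^r$ for all $r\geq 1$; (ii) $I^{(2r-1)}\subseteq I^r$ for all $r\geq 1$; (iii) for all integers $m,r\geq 1$ with $m/r\geq 2\alpha(I)/(\alpha(I)+1)$, one has $I^{(m)}\subseteq I^r$; (iv) $I^{(2r-1)}\subseteq M^{r-1}I^r$ for all $r\geq 1$; (v) $\alpha(I^{(2r-1)})\geq r\alpha(I)+r-1$ for all $r\geq 1$; (vi) $\dfrac{\alpha(I^{(m)})+1}{m+1}\leq\dfrac{\alpha(I^{(r)})}{r}$ for all $m,r\geq 1$.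
   Context: For a nonzero homogeneous ideal $J$, $\alpha(J)$ is the least degree of a nonzero form in $J$. For distinct points $P_1,\ldots,P_n\in\mathbf{P}^2$ with radical ideal $I=\bigcap_i I(P_i)$, where $I(P_i)$ is the ideal generated by all forms vanishing at $P_i$, the $m$-th symbolic power is $I^{(m)}=\bigcap_i I(P_i)^m$. For any ideal $J$, $J^0$ is the whole ring. *)

theory Defs
  imports
    "HOL-Analysis.Analysis"
    "HOL-Library.Poly_Mapping"
    "HOL-Library.Numeral_Type"
    "HOL-Computational_Algebra.Polynomial"
begin

section \<open>Ideals of a commutative ring\<close>

text \<open>
  The ambient ring is the whole type. An ideal of \<open>R\<close> is a submodule of \<open>R\<close> over itself, so the
  ideal generated by \<open>S\<close> is the library's span for the scalar multiplication \<open>(*)\<close>.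
\<close>

definition ideal_gen :: "'r::comm_ring_1 set \<Rightarrow> 'r set" where
  "ideal_gen S = module.span (*) S"

lemma module_ring_itself: "module ((*) :: 'r::comm_ring_1 \<Rightarrow> 'r \<Rightarrow> 'r)"
  by unfold_locales (simp_all add: algebra_simps)

definition ideal_mult :: "'r::comm_ring_1 set \<Rightarrow> 'r set \<Rightarrow> 'r set" where
  "ideal_mult I J = ideal_gen {a * b | a b. a \<in> I \<and> b \<in> J}"

fun ideal_power :: "'r::comm_ring_1 set \<Rightarrow> nat \<Rightarrow> 'r set" where
  "ideal_power I 0 = UNIV"
| "ideal_power I (Suc n) = ideal_mult I (ideal_power I n)"


section \<open>The homogeneous coordinate ring of the projective plane\<close>

text \<open>
  \<open>K[x\<^sub>0, x\<^sub>1, x\<^sub>2]\<close>: finitely supported maps from exponent vectors to coefficients, with the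
  convolution product of \<open>Poly_Mapping\<close>. The three variables are indexed by the type \<open>3\<close>.
\<close>

type_synonym 'a poly3 = "(3 \<Rightarrow>\<^sub>0 nat) \<Rightarrow>\<^sub>0 'a"

definition variable :: "3 \<Rightarrow> 'a::comm_ring_1 poly3" where
  "variable i = Poly_Mapping.single (Poly_Mapping.single i 1) 1"

definition monom_degree :: "(3 \<Rightarrow>\<^sub>0 nat) \<Rightarrow> nat" where
  "monom_degree e = (\<Sum>i\<in>UNIV. Poly_Mapping.lookup e i)"

text \<open>The zero polynomial is a form of every degree.\<close>

definition is_form :: "nat \<Rightarrow> 'a::comm_ring_1 poly3 \<Rightarrow> bool" where
  "is_form d F \<longleftrightarrow> (\<forall>e\<in>Poly_Mapping.keys F. monom_degree e = d)"

definition eval_poly3 :: "'a::comm_ring_1 poly3 \<Rightarrow> 'a ^ 3 \<Rightarrow> 'a" where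
  "eval_poly3 F v =
     (\<Sum>e\<in>Poly_Mapping.keys F.
        Poly_Mapping.lookup F e * (\<Prod>i\<in>UNIV. (v $ i) ^ Poly_Mapping.lookup e i))"

text \<open>
  Exponents are subtracted with truncation, which is harmless: if \<open>x\<^sub>i\<close> does not occur in a
  monomial, the corresponding coefficient below is \<open>0\<close>.
\<close>

definition partial_deriv :: "3 \<Rightarrow> 'a::comm_ring_1 poly3 \<Rightarrow> 'a poly3" where
  "partial_deriv i F =
     (\<Sum>e\<in>Poly_Mapping.keys F.
        Poly_Mapping.single (e - Poly_Mapping.single i 1)
          (of_nat (Poly_Mapping.lookup e i) * Poly_Mapping.lookup F e))"

definition irrelevant_ideal :: "'a::comm_ring_1 poly3 set" where
  "irrelevant_ideal = ideal_gen (range variable)"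

text \<open>
  Only meaningful if \<open>J\<close> contains a nonzero form, e.g. if \<open>J\<close> is a nonzero homogeneous ideal.
\<close>

definition alpha :: "'a::comm_ring_1 poly3 set \<Rightarrow> nat" where
  "alpha J = (LEAST d. \<exists>F\<in>J. F \<noteq> 0 \<and> is_form d F)"


section \<open>Points and smooth conics in the projective plane\<close>

text \<open>A point of the projective plane is a one-dimensional linear subspace of \<open>K\<^sup>3\<close>.\<close>

definition proj_plane :: "('a::field ^ 3) set set" where
  "proj_plane = {P. vec.subspace P \<and> vec.dim P = 1}"

text \<open>
  Meant for forms \<open>F\<close>. That \<open>P\<close>, as a linear subspace, contains the zero vector is harmless:
  forms of positive degree vanish there, and nonzero constants vanish nowhere.
\<close>

definition vanishes_at :: "'a::field poly3 \<Rightarrow> ('a ^ 3) set \<Rightarrow> bool" where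
  "vanishes_at F P \<longleftrightarrow> (\<forall>v\<in>P. eval_poly3 F v = 0)"

text \<open>
  The zero locus of a quadratic form satisfying the Jacobian criterion for smoothness. The
  condition \<open>vanishes_at Q P\<close> is not implied by the vanishing of the partial derivatives when
  the characteristic is \<open>2\<close>.
\<close>

definition smooth_conic :: "('a::field ^ 3) set set \<Rightarrow> bool" where
  "smooth_conic C \<longleftrightarrow>
     (\<exists>Q. is_form 2 Q \<and> Q \<noteq> 0 \<and>
          (\<forall>P\<in>proj_plane. vanishes_at Q P \<longrightarrow> (\<exists>i. \<not> vanishes_at (partial_deriv i Q) P)) \<and>
          C = {P \<in> proj_plane. vanishes_at Q P})"


section \<open>Ideals of points and their symbolic powers\<close>

definition point_ideal :: "('a::field ^ 3) set \<Rightarrow> 'a poly3 set" where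
  "point_ideal P = ideal_gen {F. (\<exists>d. is_form d F) \<and> vanishes_at F P}"

definition points_ideal :: "('a::field ^ 3) set set \<Rightarrow> 'a poly3 set" where
  "points_ideal X = (\<Inter>P\<in>X. point_ideal P)"

text \<open>The symbolic power \<open>I\<^sup>(\<^sup>m\<^sup>)\<close> of \<open>I = points_ideal X\<close>.\<close>

definition symbolic_power :: "('a::field ^ 3) set set \<Rightarrow> nat \<Rightarrow> 'a poly3 set" where
  "symbolic_power X m = (\<Inter>P\<in>X. ideal_power (point_ideal P) m)"

end

theory Submission
  imports Defs
begin

text \<open>
  Choose coordinates in which the conic is \<open>Q = x z - y\<^sup>2 = 0\<close> and all points have \<open>x \<noteq> 0\<close>, so
  that they are \<open>(1, \<tau>, \<tau>\<^sup>2)\<close> with \<open>\<tau>\<close> in a set of \<open>2 k + 1\<close> parameters. Restricting to the conic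
  sends a form of degree \<open>d\<close> in the \<open>m\<close>-th symbolic power \<open>I(m)\<close> to a polynomial of degree at most
  \<open>2 d\<close> divisible by \<open>g\<^sup>m\<close>, where \<open>g = \<Prod>(t - \<tau>)\<close>. There are \<open>F1\<close>, \<open>F2\<close> in \<open>I\<close> of degree \<open>k + 1\<close>
  restricting to \<open>g\<close> and \<open>t g\<close>, and \<open>G\<close> in \<open>I(2)\<close> of degree \<open>2 k + 1\<close> restricting to \<open>g\<^sup>2\<close>. Lifting
  the quotient by \<open>g\<^sup>m\<close> therefore gives \<open>I(2 j) = (G\<^sup>j) + Q I(2 j - 1)\<close> and
  \<open>I(2 j + 1) = G\<^sup>j (F1, F2) + Q I(2 j)\<close>, so each containment has to be checked only for products
  of \<open>Q\<close>, \<open>F1\<close>, \<open>F2\<close> and \<open>G\<close>. The inputs are \<open>G \<in> M I\<close> and \<open>G\<^sup>2 \<in> I\<^sup>3\<close>, and that each of the four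
  generators has degree at least twice its order of vanishing.
\<close>

section \<open>Ideals and their powers\<close>

abbreviation is_ideal :: "'r::comm_ring_1 set \<Rightarrow> bool" where
  "is_ideal J \<equiv> module.subspace (*) J"

lemma is_ideal_def:
  "is_ideal J \<longleftrightarrow> 0 \<in> J \<and> (\<forall>a\<in>J. \<forall>b\<in>J. a + b \<in> J) \<and> (\<forall>c. \<forall>a\<in>J. c * a \<in> J)"
  by (auto simp: module.subspace_def[OF module_ring_itself])

lemma ideal_0: "is_ideal J \<Longrightarrow> 0 \<in> J"
  and ideal_add: "is_ideal J \<Longrightarrow> a \<in> J \<Longrightarrow> b \<in> J \<Longrightarrow> a + b \<in> J"
  and ideal_mult_left: "is_ideal J \<Longrightarrow> a \<in> J \<Longrightarrow> c * a \<in> J"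
  and ideal_mult_right: "is_ideal J \<Longrightarrow> a \<in> J \<Longrightarrow> a * c \<in> J"
  by (auto simp: is_ideal_def mult.commute[of a])

lemma ideal_uminus: "is_ideal J \<Longrightarrow> a \<in> J \<Longrightarrow> - a \<in> J"
  using ideal_mult_left[of J a "-1"] by simp

lemma ideal_diff: "is_ideal J \<Longrightarrow> a \<in> J \<Longrightarrow> b \<in> J \<Longrightarrow> a - b \<in> J"
  using ideal_add[of J a "- b"] ideal_uminus[of J b] by simp

lemma ideal_sum: "is_ideal J \<Longrightarrow> (\<And>i. i \<in> A \<Longrightarrow> f i \<in> J) \<Longrightarrow> sum f A \<in> J"
  by (rule module.subspace_sum[OF module_ring_itself])

lemma is_ideal_UNIV: "is_ideal UNIV"
  by (simp add: is_ideal_def)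

lemma is_ideal_INT: "(\<And>i. i \<in> A \<Longrightarrow> is_ideal (J i)) \<Longrightarrow> is_ideal (\<Inter>i\<in>A. J i)"
  by (simp add: is_ideal_def)

text \<open>Used to reduce claims about a product ideal to generators: the elements that satisfy the
  claim form a colon ideal.\<close>

lemma is_ideal_colon: "is_ideal J \<Longrightarrow> is_ideal {a. a * q \<in> J}"
  by (auto simp: is_ideal_def distrib_right mult.assoc)

lemma is_ideal_ideal_gen: "is_ideal (ideal_gen S)"
  unfolding ideal_gen_def by (rule module.subspace_span[OF module_ring_itself])

lemma ideal_gen_superset: "a \<in> S \<Longrightarrow> a \<in> ideal_gen S"
  unfolding ideal_gen_def by (rule module.span_base[OF module_ring_itself])

lemma ideal_gen_minimal: "S \<subseteq> J \<Longrightarrow> is_ideal J \<Longrightarrow> ideal_gen S \<subseteq> J"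
  unfolding ideal_gen_def by (rule module.span_minimal[OF module_ring_itself])

lemma is_ideal_ideal_mult: "is_ideal (ideal_mult I J)"
  by (simp add: ideal_mult_def is_ideal_ideal_gen)

lemma is_ideal_ideal_power: "is_ideal (ideal_power I m)"
  by (cases m) (simp_all add: is_ideal_UNIV is_ideal_ideal_mult)

lemma ideal_mult_I: "a \<in> I \<Longrightarrow> b \<in> J \<Longrightarrow> a * b \<in> ideal_mult I J"
  unfolding ideal_mult_def by (rule ideal_gen_superset) blast

lemma ideal_mult_subset:
  "(\<And>a b. a \<in> I \<Longrightarrow> b \<in> J \<Longrightarrow> a * b \<in> L) \<Longrightarrow> is_ideal L \<Longrightarrow> ideal_mult I J \<subseteq> L"
  unfolding ideal_mult_def by (rule ideal_gen_minimal) auto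

lemma ideal_mult_subset_right: "is_ideal J \<Longrightarrow> ideal_mult I J \<subseteq> J"
  by (rule ideal_mult_subset) (auto intro: ideal_mult_left)

lemma ideal_power_1: "is_ideal I \<Longrightarrow> ideal_power I 1 = I"
proof -
  assume I: "is_ideal I"
  have "ideal_mult I UNIV \<subseteq> I"
    by (rule ideal_mult_subset) (auto intro: ideal_mult_right I)
  moreover have "I \<subseteq> ideal_mult I UNIV"
    using ideal_mult_I[of _ I 1 UNIV] by auto
  ultimately show ?thesis by auto
qed

lemma ideal_power_add:
  "a \<in> ideal_power I m \<Longrightarrow> b \<in> ideal_power I n \<Longrightarrow> a * b \<in> ideal_power I (m + n)"
proof (induction m arbitrary: a)
  case 0
  then show ?case by (simp add: ideal_mult_left is_ideal_ideal_power)
next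
  case (Suc m)
  have "ideal_mult I (ideal_power I m) \<subseteq> {a. a * b \<in> ideal_power I (Suc m + n)}"
  proof (rule ideal_mult_subset)
    fix c d assume "c \<in> I" "d \<in> ideal_power I m"
    then have "c * (d * b) \<in> ideal_power I (Suc m + n)"
      using Suc.IH[OF _ Suc.prems(2)] by (simp add: ideal_mult_I)
    then show "c * d \<in> {a. a * b \<in> ideal_power I (Suc m + n)}"
      by (simp add: mult.assoc)
  qed (intro is_ideal_colon is_ideal_ideal_power)
  with Suc.prems show ?case by auto
qed

lemma ideal_power_antimono: "m \<le> n \<Longrightarrow> ideal_power I n \<subseteq> ideal_power I m"
proof (induction n rule: dec_induct)
  case (step n)
  then show ?case
    using ideal_mult_subset_right[OF is_ideal_ideal_power, of I I n] by auto
qed simp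

lemma ideal_power_base: "a \<in> I \<Longrightarrow> a ^ m \<in> ideal_power I m"
  by (induction m) (simp_all add: ideal_mult_I)

lemma ideal_power_power: "a \<in> ideal_power I m \<Longrightarrow> a ^ j \<in> ideal_power I (m * j)"
proof (induction j)
  case (Suc j)
  then show ?case using ideal_power_add[of a I m "a ^ j" "m * j"] by simp
qed simp

text \<open>Colon ideals reduce both factors in turn to products of generators, which only have to
  be regrouped.\<close>

lemma ideal_mult_powers_mult:
  assumes "a \<in> ideal_mult (ideal_power I p) (ideal_power J q)"
    and "b \<in> ideal_mult (ideal_power I p') (ideal_power J q')"
  shows "a * b \<in> ideal_mult (ideal_power I (p + p')) (ideal_power J (q + q'))" (is "_ \<in> ?R")
proof -
  have *: "(a * b) * (c * d) \<in> ?R"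
    if "a \<in> ideal_power I p" "b \<in> ideal_power J q"
      "c \<in> ideal_power I p'" "d \<in> ideal_power J q'" for a b c d
  proof -
    have "(a * c) * (b * d) \<in> ?R"
      using that by (intro ideal_mult_I ideal_power_add)
    then show ?thesis by (simp add: ac_simps)
  qed
  have "ideal_mult (ideal_power I p') (ideal_power J q') \<subseteq> {b. b * a \<in> ?R}"
  proof (rule ideal_mult_subset)
    fix c d assume cd: "c \<in> ideal_power I p'" "d \<in> ideal_power J q'"
    have "ideal_mult (ideal_power I p) (ideal_power J q) \<subseteq> {a. a * (c * d) \<in> ?R}"
      by (rule ideal_mult_subset)
         (auto intro!: * cd is_ideal_colon is_ideal_ideal_mult)
    then show "c * d \<in> {b. b * a \<in> ?R}"
      using assms(1) by (auto simp: mult.commute)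
  qed (intro is_ideal_colon is_ideal_ideal_mult)
  with assms(2) show ?thesis by (auto simp: mult.commute)
qed

text \<open>Factors for different roots are coprime: the product over \<open>T\<close> does not
  vanish at the new \<open>\<tau>\<close>, so the whole power of \<open>[:- \<tau>, 1:]\<close>
  divides the cofactor.\<close>

lemma prod_linear_powers_dvd:
  fixes f :: "'a::field poly"
  assumes "finite T" and "\<And>\<tau>. \<tau> \<in> T \<Longrightarrow> [:- \<tau>, 1:] ^ m dvd f"
  shows "(\<Prod>\<tau>\<in>T. [:- \<tau>, 1:]) ^ m dvd f"
  using assms
proof (induction T rule: finite_induct)
  case (insert \<tau> T)
  let ?A = "(\<Prod>\<sigma>\<in>T. [:- \<sigma>, 1:]) ^ m"
  obtain q where q: "f = ?A * q"
    using insert by (auto elim: dvdE)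
  have "poly ?A \<tau> \<noteq> 0"
    using insert.hyps by (auto simp: poly_prod poly_power)
  then have A: "order \<tau> ?A = 0" "?A \<noteq> 0"
    using order_root[of ?A \<tau>] by (blast, auto)
  have "[:- \<tau>, 1:] ^ m dvd ?A * q"
    using insert.prems q by auto
  then have "[:- \<tau>, 1:] ^ m dvd q"
  proof (cases "q = 0")
    case False
    then have "?A * q \<noteq> 0" using A(2) by simp
    moreover from order_mult[OF this, of \<tau>] have "order \<tau> (?A * q) = order \<tau> q"
      using A(1) by linarith
    moreover note \<open>[:- \<tau>, 1:] ^ m dvd ?A * q\<close>
    ultimately show ?thesis
      using False by (metis order_divides)
  qed simp
  then have "[:- \<tau>, 1:] ^ m * ?A dvd f"
    unfolding q by (subst mult.commute) (rule mult_dvd_mono, simp_all)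
  then show ?case
    using insert.hyps by (simp only: prod.insert power_mult_distrib not_False_eq_True)
qed simp

section \<open>Ring homomorphisms\<close>

definition is_ring_hom :: "('r::comm_ring_1 \<Rightarrow> 's::comm_ring_1) \<Rightarrow> bool" where
  "is_ring_hom h \<longleftrightarrow> h 0 = 0 \<and> h 1 = 1 \<and> (\<forall>a b. h (a + b) = h a + h b) \<and> (\<forall>a b. h (a * b) = h a * h b)"

context
  fixes h :: "'r::comm_ring_1 \<Rightarrow> 's::comm_ring_1"
  assumes h: "is_ring_hom h"
begin

lemma ring_hom_0: "h 0 = 0" and ring_hom_1: "h 1 = 1"
  and ring_hom_add: "h (a + b) = h a + h b" and ring_hom_mult: "h (a * b) = h a * h b"
  using h by (auto simp: is_ring_hom_def)

lemma ring_hom_uminus: "h (- a) = - h a"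
  using ring_hom_add[of "- a" a] ring_hom_0 by (simp add: eq_neg_iff_add_eq_0)

lemma ring_hom_diff: "h (a - b) = h a - h b"
  using ring_hom_add[of a "- b"] by (simp add: ring_hom_uminus)

lemma ring_hom_power: "h (a ^ n) = h a ^ n"
  by (induction n) (simp_all add: ring_hom_1 ring_hom_mult)

lemma ring_hom_sum: "h (sum f A) = (\<Sum>i\<in>A. h (f i))"
  by (induction A rule: infinite_finite_induct) (simp_all add: ring_hom_0 ring_hom_add)

lemma ring_hom_prod: "h (prod f A) = (\<Prod>i\<in>A. h (f i))"
  by (induction A rule: infinite_finite_induct) (simp_all add: ring_hom_1 ring_hom_mult)

end

lemmas ring_hom_simps = ring_hom_0 ring_hom_1 ring_hom_add ring_hom_mult ring_hom_uminus
  ring_hom_diff ring_hom_power ring_hom_sum ring_hom_prod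

lemma is_ring_hom_comp: "is_ring_hom f \<Longrightarrow> is_ring_hom g \<Longrightarrow> is_ring_hom (\<lambda>a. f (g a))"
  by (simp add: is_ring_hom_def)

lemma is_ring_hom_poly: "is_ring_hom (\<lambda>p. poly p c)"
  by (simp add: is_ring_hom_def)

lemma is_ring_hom_const_poly: "is_ring_hom (\<lambda>c. [:c:])"
  by (simp add: is_ring_hom_def one_pCons)

lemma monom_sum: "monom (sum f A) d = (\<Sum>i\<in>A. monom (f i) d)"
  by (induction A rule: infinite_finite_induct) (simp_all add: add_monom[symmetric])

lemma poly_sum_monom_le:
  fixes f :: "'c::comm_ring_1 poly"
  assumes "degree f \<le> n" shows "(\<Sum>b\<le>n. smult (coeff f b) (monom 1 b)) = f"
  using poly_as_sum_of_monoms'[OF assms] by (simp add: smult_monom)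

section \<open>A conic with a rational parametrization\<close>

text \<open>
  \<open>\<Phi>\<close> restricts to the conic: the coefficient of \<open>X\<^sup>d\<close> in \<open>\<Phi> F\<close> is the value at \<open>(1, t, t\<^sup>2)\<close> of the
  component of degree \<open>d\<close> of \<open>F\<close>. \<open>\<psi> \<tau>\<close> multiplies the two linear forms vanishing at \<open>(1, \<tau>, \<tau>\<^sup>2)\<close> by
  an indeterminate \<open>\<epsilon>\<close>, so that the power of \<open>\<epsilon>\<close> dividing \<open>\<psi> \<tau> F\<close> is the multiplicity of \<open>F\<close> at that
  point.
\<close>

locale parametrized_conic =
  fixes \<iota> :: "'a::field \<Rightarrow> 'r::idom" and x y z :: 'r
    and \<Phi> :: "'r \<Rightarrow> 'a poly poly" and \<psi> :: "'a \<Rightarrow> 'r \<Rightarrow> 'r poly"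
  assumes generated: "\<And>S F. (\<And>c. \<iota> c \<in> S) \<Longrightarrow> x \<in> S \<Longrightarrow> y \<in> S \<Longrightarrow> z \<in> S \<Longrightarrow>
      (\<And>a b. a \<in> S \<Longrightarrow> b \<in> S \<Longrightarrow> a + b \<in> S) \<Longrightarrow> (\<And>a b. a \<in> S \<Longrightarrow> b \<in> S \<Longrightarrow> a * b \<in> S) \<Longrightarrow> F \<in> S"
    and hom_const: "is_ring_hom \<iota>"
    and hom_Phi: "is_ring_hom \<Phi>"
    and Phi_const: "\<Phi> (\<iota> c) = [:[:c:]:]"
    and Phi_x: "\<Phi> x = [:0, 1:]" and Phi_y: "\<Phi> y = [:0, [:0, 1:]:]"
    and Phi_z: "\<Phi> z = [:0, [:0, 0, 1:]:]"
    and hom_psi: "is_ring_hom (\<psi> \<tau>)"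
    and psi_const: "\<psi> \<tau> (\<iota> c) = [:\<iota> c:]"
    and psi_x: "\<psi> \<tau> x = [:x:]"
    and psi_y: "\<psi> \<tau> y = [:\<iota> \<tau> * x, y - \<iota> \<tau> * x:]"
    and psi_z: "\<psi> \<tau> z = [:\<iota> (\<tau>\<^sup>2) * x, z - \<iota> (\<tau>\<^sup>2) * x:]"
begin

lemmas const_simps = ring_hom_simps[OF hom_const]
lemmas Phi_simps = ring_hom_simps[OF hom_Phi] Phi_const Phi_x Phi_y Phi_z
lemmas psi_simps = ring_hom_simps[OF hom_psi] psi_const psi_x psi_y psi_z

definition Q :: 'r where "Q = x * z - y\<^sup>2"

text \<open>For \<open>b \<le> 2 * d\<close> this is the monomial of degree \<open>d\<close>, at
  most linear in \<open>y\<close>, that restricts to \<open>t ^ b\<close> on the conic. These are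
  the normal forms under rewriting \<open>y ^ 2\<close> to \<open>x z\<close>.\<close>

definition mon :: "nat \<Rightarrow> nat \<Rightarrow> 'r" where
  "mon d b = x ^ (d - (b + 1) div 2) * y ^ (b mod 2) * z ^ (b div 2)"

text \<open>A linear section of \<open>\<Phi>\<close>; \<open>hlift d\<close> is meaningful for polynomials of degree at most \<open>2 d\<close>.\<close>

definition hlift :: "nat \<Rightarrow> 'a poly \<Rightarrow> 'r" where
  "hlift d f = (\<Sum>b\<le>2 * d. \<iota> (coeff f b) * mon d b)"

definition lift :: "'a poly poly \<Rightarrow> 'r" where
  "lift p = (\<Sum>d\<le>degree p. hlift d (coeff p d))"

text \<open>A form of degree \<open>d\<close> restricts to a polynomial of degree at most
  \<open>2 * d\<close>; in this range \<open>hlift\<close> is a section.\<close>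

definition cone :: "'a poly poly set" where
  "cone = {p. \<forall>d. degree (coeff p d) \<le> 2 * d}"

section \<open>The kernel of the restriction to the conic\<close>

lemma Phi_mon: "b \<le> 2 * d \<Longrightarrow> \<Phi> (mon d b) = monom (monom 1 b) d"
proof -
  assume b: "b \<le> 2 * d"
  have X: "\<Phi> x = monom 1 1" and Y: "\<Phi> y = monom (monom 1 1) 1" and Z: "\<Phi> z = monom (monom 1 2) 1"
    by (simp_all add: Phi_simps monom_altdef numeral_2_eq_2)
  have *: "\<Phi> (mon d b) =
      monom (monom 1 (b mod 2 + b div 2 * 2)) (d - (b + 1) div 2 + b mod 2 + b div 2)"
    by (simp add: mon_def ring_hom_simps[OF hom_Phi] X Y Z monom_power mult_monom)
  have "d - (b + 1) div 2 + b mod 2 + b div 2 = d" "b mod 2 + b div 2 * 2 = b"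
    using b by presburger+
  with * show ?thesis by metis
qed

lemma hlift_0: "hlift d 0 = 0"
  by (simp add: hlift_def const_simps)

lemma hlift_add: "hlift d (f + g) = hlift d f + hlift d g"
  by (simp add: hlift_def const_simps algebra_simps sum.distrib)

lemma hlift_smult: "hlift d (smult c f) = \<iota> c * hlift d f"
  by (simp add: hlift_def const_simps sum_distrib_left mult.assoc)

lemma hlift_const: "hlift d [:c:] = \<iota> c * x ^ d"
proof -
  have "hlift d [:c:] = (\<Sum>b\<in>{0}. \<iota> (coeff [:c:] b) * mon d b)"
    unfolding hlift_def
    by (rule sum.mono_neutral_right) (auto simp: coeff_pCons const_simps split: nat.splits)
  then show ?thesis by (simp add: mon_def)
qed

lemma Phi_hlift:
  assumes "degree f \<le> 2 * d" shows "\<Phi> (hlift d f) = monom f d"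
proof -
  have "\<Phi> (hlift d f) = (\<Sum>b\<le>2 * d. monom (smult (coeff f b) (monom 1 b)) d)"
    unfolding hlift_def ring_hom_simps[OF hom_Phi]
    by (intro sum.cong) (auto simp: Phi_mon Phi_const smult_monom)
  also have "\<dots> = monom (\<Sum>b\<le>2 * d. smult (coeff f b) (monom 1 b)) d"
    by (simp add: monom_sum)
  also have "\<dots> = monom f d"
    using poly_sum_monom_le[OF assms] by simp
  finally show ?thesis .
qed


lemma mon_Suc: "b \<le> 2 * d \<Longrightarrow> mon (Suc d) b = x * mon d b"
proof -
  assume "b \<le> 2 * d"
  then have "Suc d - (b + 1) div 2 = Suc (d - (b + 1) div 2)" by presburger
  then show ?thesis by (simp add: mon_def mult.assoc)
qed

lemma mon_Suc_Suc: "mon (Suc d) (Suc (Suc b)) = z * mon d b"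
  by (simp add: mon_def ac_simps)

text \<open>For even \<open>b\<close> both sides agree. For odd \<open>b\<close> the product
  contains \<open>y ^ 2\<close>, and rewriting it to \<open>x z\<close> costs a multiple of
  \<open>Q\<close>.\<close>

lemma mon_Suc_y: "b \<le> 2 * d \<Longrightarrow> Q dvd mon (Suc d) (Suc b) - y * mon d b"
proof (cases "even b")
  case True
  then obtain c where "b = 2 * c" by (elim evenE)
  then show ?thesis by (simp add: mon_def mult.assoc mult.left_commute)
next
  case False
  assume "b \<le> 2 * d"
  obtain c where c: "b = 2 * c + 1" using False by (elim oddE)
  with \<open>b \<le> 2 * d\<close> obtain e where e: "d = Suc (c + e)"
    by (metis add_Suc less_iff_Suc_add mult_less_cancel1 Suc_le_eq Suc_eq_plus1 add.commute)
  have "mon (Suc d) (Suc b) = x ^ Suc e * z ^ Suc c" "mon d b = x ^ e * y * z ^ c"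
    by (simp_all add: mon_def c e Suc_diff_le)
  then have "mon (Suc d) (Suc b) - y * mon d b = Q * (x ^ e * z ^ c)"
    by (simp add: Q_def algebra_simps power2_eq_square)
  then show ?thesis by simp
qed

lemma hlift_Suc: "degree f \<le> 2 * d \<Longrightarrow> hlift (Suc d) f = x * hlift d f"
  by (simp add: hlift_def coeff_eq_0 const_simps sum_distrib_left mon_Suc ac_simps)

lemma hlift_Suc_y:
  assumes "degree f \<le> 2 * d" shows "Q dvd hlift (Suc d) (pCons 0 f) - y * hlift d f"
proof -
  have "hlift (Suc d) (pCons 0 f) = (\<Sum>b\<le>2 * d. \<iota> (coeff f b) * mon (Suc d) (Suc b))"
  proof -
    have "2 * Suc d = Suc (Suc (2 * d))" by simp
    then have "hlift (Suc d) (pCons 0 f) = (\<Sum>b\<le>Suc (2 * d). \<iota> (coeff f b) * mon (Suc d) (Suc b))"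
      unfolding hlift_def by (simp only: sum.atMost_Suc_shift) (simp add: const_simps)
    then show ?thesis using assms by (simp add: coeff_eq_0 const_simps)
  qed
  then have "hlift (Suc d) (pCons 0 f) - y * hlift d f =
      (\<Sum>b\<le>2 * d. \<iota> (coeff f b) * (mon (Suc d) (Suc b) - y * mon d b))"
    by (simp add: hlift_def sum_distrib_left sum_subtractf[symmetric] algebra_simps)
  also have "Q dvd \<dots>"
    by (intro dvd_sum dvd_mult mon_Suc_y) simp
  finally show ?thesis .
qed

lemma hlift_Suc_z: "hlift (Suc d) (pCons 0 (pCons 0 f)) = z * hlift d f"
  by (simp add: hlift_def sum.atMost_Suc_shift const_simps mon_Suc_Suc sum_distrib_left ac_simps
      del: sum.atMost_Suc)

lemma lift_eq_sum:
  assumes "degree p \<le> D" shows "lift p = (\<Sum>d\<le>D. hlift d (coeff p d))"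
  unfolding lift_def
  by (rule sum.mono_neutral_left) (use assms in \<open>auto simp: coeff_eq_0 hlift_0\<close>)

lemma lift_add: "lift (p + q) = lift p + lift q"
  using degree_add_le_max[of p q]
  by (simp add: lift_eq_sum[of _ "max (degree p) (degree q)"] hlift_add sum.distrib)

lemma lift_pCons: "lift (pCons 0 (smult c p)) = (\<Sum>d\<le>degree p. hlift (Suc d) (c * coeff p d))"
proof -
  have "degree (pCons 0 (smult c p)) \<le> Suc (degree p)"
    by (meson degree_pCons_le degree_smult_le le_trans Suc_le_mono)
  then have "lift (pCons 0 (smult c p)) = (\<Sum>d\<le>Suc (degree p). hlift d (coeff (pCons 0 (smult c p)) d))"
    by (rule lift_eq_sum)
  then show ?thesis
    by (simp only: sum.atMost_Suc_shift) (simp add: hlift_0)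
qed

lemma cone_add: "p \<in> cone \<Longrightarrow> q \<in> cone \<Longrightarrow> p + q \<in> cone"
  by (auto simp: cone_def intro: degree_add_le)

lemma cone_mult:
  assumes "p \<in> cone" "q \<in> cone" shows "p * q \<in> cone"
  unfolding cone_def
proof (intro CollectI allI)
  fix d
  have "degree (coeff p i * coeff q (d - i)) \<le> 2 * d" if "i \<le> d" for i
  proof -
    have "degree (coeff p i * coeff q (d - i)) \<le> 2 * i + 2 * (d - i)"
      using assms by (intro order.trans[OF degree_mult_le] add_mono) (auto simp: cone_def)
    with that show ?thesis by simp
  qed
  then show "degree (coeff (p * q) d) \<le> 2 * d"
    by (auto simp: coeff_mult intro!: degree_sum_le)
qed

text \<open>Here \<open>generated\<close> acts as structural induction on ring elements.\<close>

lemma Phi_in_cone: "\<Phi> F \<in> cone"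
proof (rule generated[of "{F. \<Phi> F \<in> cone}", simplified])
qed (auto simp: Phi_simps cone_add cone_mult, auto simp: cone_def coeff_pCons split: nat.splits)

text \<open>Lifting commutes modulo \<open>Q\<close> with multiplication by constants and by each
  coordinate, so reducing to normal form changes an element only by a multiple of
  \<open>Q\<close>.\<close>

lemma lift_Phi: "Q dvd lift (\<Phi> F) - F"
proof -
  define W where "W = {F. Q dvd lift (\<Phi> F) - F}"
  have add: "a + b \<in> W" if "a \<in> W" "b \<in> W" for a b
    using dvd_add[of Q "lift (\<Phi> a) - a" "lift (\<Phi> b) - b"] that
    by (simp add: W_def Phi_simps lift_add algebra_simps)
  have congr: "v * F \<in> W" if "F \<in> W" "Q dvd lift (\<Phi> (v * F)) - v * lift (\<Phi> F)" for v F
    using dvd_add[OF that(2) dvd_mult[of Q "lift (\<Phi> F) - F" v]] that(1)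
    by (simp add: W_def algebra_simps)
  have deg: "degree (coeff (\<Phi> F) d) \<le> 2 * d" for F d
    using Phi_in_cone[of F] by (simp add: cone_def)
  have const: "\<iota> c * F \<in> W" if "F \<in> W" for c F
  proof (rule congr[OF that])
    show "Q dvd lift (\<Phi> (\<iota> c * F)) - \<iota> c * lift (\<Phi> F)"
      by (simp add: Phi_simps lift_eq_sum[of _ "degree (\<Phi> F)"] hlift_smult sum_distrib_left)
  qed
  have x: "x * F \<in> W" if "F \<in> W" for F
  proof (rule congr[OF that])
    show "Q dvd lift (\<Phi> (x * F)) - x * lift (\<Phi> F)"
      using lift_pCons[of 1 "\<Phi> F"] by (simp add: Phi_simps hlift_Suc deg lift_def[of "\<Phi> F"] sum_distrib_left)
  qed
  have z: "z * F \<in> W" if "F \<in> W" for F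
  proof (rule congr[OF that])
    have "lift (\<Phi> (z * F)) = (\<Sum>d\<le>degree (\<Phi> F). hlift (Suc d) (pCons 0 (pCons 0 (coeff (\<Phi> F) d))))"
      by (simp add: Phi_simps lift_pCons)
    then show "Q dvd lift (\<Phi> (z * F)) - z * lift (\<Phi> F)"
      by (simp add: hlift_Suc_z lift_def sum_distrib_left)
  qed
  have y: "y * F \<in> W" if "F \<in> W" for F
  proof (rule congr[OF that])
    have "lift (\<Phi> (y * F)) = (\<Sum>d\<le>degree (\<Phi> F). hlift (Suc d) (pCons 0 (coeff (\<Phi> F) d)))"
      by (simp add: Phi_simps lift_pCons)
    then have "lift (\<Phi> (y * F)) - y * lift (\<Phi> F) =
        (\<Sum>d\<le>degree (\<Phi> F). hlift (Suc d) (pCons 0 (coeff (\<Phi> F) d)) - y * hlift d (coeff (\<Phi> F) d))"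
      by (simp add: lift_def sum_distrib_left sum_subtractf)
    also have "Q dvd \<dots>"
      by (intro dvd_sum hlift_Suc_y deg)
    finally show "Q dvd lift (\<Phi> (y * F)) - y * lift (\<Phi> F)" .
  qed
  have "F \<in> {F. \<forall>N\<in>W. F * N \<in> W}"
    by (rule generated) (auto simp: const x y z add distrib_right mult.assoc)
  moreover have "1 \<in> W"
    using hlift_const[of 0 1] by (simp add: W_def Phi_simps lift_def const_simps flip: one_pCons)
  ultimately have "F * 1 \<in> W" by blast
  then show ?thesis by (simp add: W_def)
qed

lemma Phi_Q: "\<Phi> Q = 0"
  by (simp add: Q_def Phi_simps power2_eq_square)

text \<open>With \<open>Phi_Q\<close> this identifies the kernel of the restriction as the ideal
  generated by \<open>Q\<close>.\<close>

lemma kernel_Phi: "\<Phi> F = 0 \<Longrightarrow> Q dvd F"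
  using lift_Phi[of F] by (simp add: lift_def hlift_0)

end

section \<open>Multiplicity at a point of the conic\<close>

lemma is_ideal_dvd_hom: "is_ring_hom h \<Longrightarrow> is_ideal {a. d dvd h a}"
  by (auto simp: is_ideal_def is_ring_hom_def)

lemma ideal_power_dvd_hom:
  assumes h: "is_ring_hom h" and I: "\<And>a. a \<in> I \<Longrightarrow> d dvd h a"
  shows "F \<in> ideal_power I m \<Longrightarrow> d ^ m dvd h F"
proof (induction m arbitrary: F)
  case (Suc m)
  have "ideal_mult I (ideal_power I m) \<subseteq> {a. d ^ Suc m dvd h a}"
    by (rule ideal_mult_subset[OF _ is_ideal_dvd_hom[OF h]])
       (auto simp: ring_hom_mult[OF h] intro!: mult_dvd_mono I Suc.IH)
  with Suc.prems show ?case by auto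
qed simp

lemma poly_shift_split: "pCons (coeff f 0) (poly_shift 1 f) = f"
  by (rule poly_eqI) (simp add: coeff_pCons coeff_poly_shift split: nat.splits)

lemma degree_poly_shift_1: "degree (poly_shift 1 f) \<le> degree f - 1"
  by (rule degree_le) (auto simp: coeff_poly_shift coeff_eq_0)

context parametrized_conic
begin

definition pt_ideal :: "'a \<Rightarrow> 'r set" where
  "pt_ideal \<tau> = ideal_gen {y - \<iota> \<tau> * x, z - \<iota> (\<tau>\<^sup>2) * x}"

text \<open>Setting \<open>\<epsilon> = 0\<close> evaluates at the point
  \<open>(1, \<tau>, \<tau>\<^sup>2)\<close>; a form of degree \<open>d\<close> becomes its value
  there times \<open>x ^ d\<close>.\<close>

definition ev :: "'a \<Rightarrow> 'r \<Rightarrow> 'r" where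
  "ev \<tau> F = poly (\<psi> \<tau> F) 0"

lemma hom_ev: "is_ring_hom (ev \<tau>)"
  unfolding ev_def by (rule is_ring_hom_comp[OF is_ring_hom_poly hom_psi])

lemma ev_const: "ev \<tau> (\<iota> c) = \<iota> c" and ev_x: "ev \<tau> x = x"
  and ev_y: "ev \<tau> y = \<iota> \<tau> * x" and ev_z: "ev \<tau> z = \<iota> (\<tau>\<^sup>2) * x"
  by (simp_all add: ev_def psi_simps)

lemmas ev_simps = ring_hom_simps[OF hom_ev] ev_const ev_x ev_y ev_z

lemma is_ideal_pt_ideal: "is_ideal (pt_ideal \<tau>)"
  by (simp add: pt_ideal_def is_ideal_ideal_gen)

text \<open>Each factor \<open>\<epsilon>\<close> comes with an element of the point ideal. This
  holds for the coordinates and passes to products because the coefficients are convolved.\<close>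

lemma coeff_psi_in_ideal_power: "coeff (\<psi> \<tau> F) i \<in> ideal_power (pt_ideal \<tau>) i"
proof -
  let ?p = "ideal_power (pt_ideal \<tau>)"
  define S where "S = {F. \<forall>i. coeff (\<psi> \<tau> F) i \<in> ?p i}"
  have p: "is_ideal (?p i)" for i by (rule is_ideal_ideal_power)
  have gens: "a \<in> ?p 1" if "a \<in> {y - \<iota> \<tau> * x, z - \<iota> (\<tau>\<^sup>2) * x}" for a
    using ideal_gen_superset[OF that] ideal_power_1[OF is_ideal_pt_ideal] by (simp add: pt_ideal_def)
  have const: "[:c:] \<in> {q. \<forall>i. coeff q i \<in> ?p i}" for c
    using ideal_0[OF p] by (auto simp: coeff_pCons simp del: ideal_power.simps(2) split: nat.splits)
  have linear: "[:c, d:] \<in> {q. \<forall>i. coeff q i \<in> ?p i}" if "d \<in> ?p 1" for c d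
    using that ideal_0[OF p] by (auto simp: coeff_pCons simp del: ideal_power.simps(2) split: nat.splits)
  have "F \<in> S"
  proof (rule generated)
    show "\<iota> c \<in> S" for c
      using const[of "\<iota> c"] by (simp add: S_def psi_simps)
    show "x \<in> S"
      using const[of x] by (simp add: S_def psi_simps)
    show "y \<in> S"
      using linear[OF gens, of "y - \<iota> \<tau> * x"] by (simp add: S_def psi_simps)
    show "z \<in> S"
      using linear[OF gens, of "z - \<iota> (\<tau>\<^sup>2) * x"] by (simp add: S_def psi_simps)
    show "a + b \<in> S" if "a \<in> S" "b \<in> S" for a b
      using that by (auto simp: S_def psi_simps intro!: ideal_add p)
    show "a * b \<in> S" if "a \<in> S" "b \<in> S" for a b
    proof -
      have "coeff (\<psi> \<tau> a) j * coeff (\<psi> \<tau> b) (i - j) \<in> ?p i" if "j \<le> i" for i j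
        using ideal_power_add[of "coeff (\<psi> \<tau> a) j" _ j "coeff (\<psi> \<tau> b) (i - j)" "i - j"]
          \<open>a \<in> S\<close> \<open>b \<in> S\<close> that by (auto simp: S_def)
      then show ?thesis
        by (auto simp: S_def psi_simps coeff_mult intro!: ideal_sum p)
    qed
  qed
  then show ?thesis by (simp add: S_def)
qed

lemma poly_psi_1: "poly (\<psi> \<tau> F) 1 = F"
  by (rule generated[of "{F. poly (\<psi> \<tau> F) 1 = F}", simplified]) (simp_all add: psi_simps)

text \<open>The generators of the point ideal acquire a factor \<open>\<epsilon>\<close>.
  Conversely, the coefficients below \<open>m\<close> vanish, the others lie in the
  \<open>m\<close>-th power, and their sum, the value at \<open>\<epsilon> = 1\<close>, is
  \<open>F\<close> itself.\<close>

lemma in_pt_ideal_power_iff: "F \<in> ideal_power (pt_ideal \<tau>) m \<longleftrightarrow> [:0, 1:] ^ m dvd \<psi> \<tau> F"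
proof
  have "pt_ideal \<tau> \<subseteq> {F. [:0, 1:] dvd \<psi> \<tau> F}"
    unfolding pt_ideal_def
    by (rule ideal_gen_minimal[OF _ is_ideal_dvd_hom[OF hom_psi]])
       (auto simp: psi_simps poly_eq_iff dvd_iff_poly_eq_0[of 0, simplified])
  then show "F \<in> ideal_power (pt_ideal \<tau>) m \<Longrightarrow> [:0, 1:] ^ m dvd \<psi> \<tau> F"
    by (intro ideal_power_dvd_hom[OF hom_psi]) auto
next
  assume "[:0, 1:] ^ m dvd \<psi> \<tau> F"
  then have "monom 1 m dvd \<psi> \<tau> F" by (simp add: monom_altdef)
  then have 0: "coeff (\<psi> \<tau> F) i = 0" if "i < m" for i
    using that by (simp add: monom_1_dvd_iff')
  have "coeff (\<psi> \<tau> F) i \<in> ideal_power (pt_ideal \<tau>) m" for i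
  proof (cases "i < m")
    case True
    then show ?thesis by (simp add: 0 ideal_0 is_ideal_ideal_power)
  next
    case False
    then show ?thesis
      using coeff_psi_in_ideal_power[of \<tau> F i] ideal_power_antimono[of m i] by auto
  qed
  then have "(\<Sum>i\<le>degree (\<psi> \<tau> F). coeff (\<psi> \<tau> F) i) \<in> ideal_power (pt_ideal \<tau>) m"
    by (intro ideal_sum is_ideal_ideal_power)
  then show "F \<in> ideal_power (pt_ideal \<tau>) m"
    using poly_psi_1[of \<tau> F] by (simp add: poly_altdef)
qed

lemma in_pt_ideal_iff: "F \<in> pt_ideal \<tau> \<longleftrightarrow> ev \<tau> F = 0"
  using in_pt_ideal_power_iff[of F \<tau> 1] dvd_iff_poly_eq_0[of 0 "\<psi> \<tau> F"]
  unfolding ideal_power_1[OF is_ideal_pt_ideal] by (simp add: ev_def)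

text \<open>Both generators of the point ideal restrict to multiples of \<open>t - \<tau>\<close>,
  so multiplicity \<open>m\<close> becomes a root of order at least \<open>m\<close>.\<close>

lemma Phi_dvd:
  assumes "F \<in> ideal_power (pt_ideal \<tau>) m" shows "[:- \<tau>, 1:] ^ m dvd coeff (\<Phi> F) d"
proof -
  have y: "\<Phi> (y - \<iota> \<tau> * x) = [:[:- \<tau>, 1:]:] * [:0, 1:]"
    by (simp add: Phi_simps)
  have z: "\<Phi> (z - \<iota> (\<tau>\<^sup>2) * x) = [:[:- \<tau>, 1:]:] * [:0, [:\<tau>, 1:]:]"
    by (simp add: Phi_simps power2_eq_square)
  have "pt_ideal \<tau> \<subseteq> {F. [:[:- \<tau>, 1:]:] dvd \<Phi> F}"
    unfolding pt_ideal_def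
    by (rule ideal_gen_minimal[OF _ is_ideal_dvd_hom[OF hom_Phi]])
       (use y z in \<open>auto simp only: dvd_triv_left\<close>)
  then have "[:[:- \<tau>, 1:]:] ^ m dvd \<Phi> F"
    using assms by (intro ideal_power_dvd_hom[OF hom_Phi]) auto
  then have "[:[:- \<tau>, 1:] ^ m:] dvd \<Phi> F"
    by (simp add: poly_const_pow)
  then show ?thesis
    by (simp add: const_poly_dvd_iff)
qed

lemma ev_hlift:
  assumes "degree f \<le> 2 * d" shows "ev \<tau> (hlift d f) = \<iota> (poly f \<tau>) * x ^ d"
proof -
  have *: "ev \<tau> (mon d b) = \<iota> (\<tau> ^ b) * x ^ d" if "b \<le> 2 * d" for b
  proof -
    have "\<iota> (\<tau> ^ (b mod 2 + 2 * (b div 2))) = \<iota> \<tau> ^ (b mod 2) * \<iota> (\<tau>\<^sup>2) ^ (b div 2)"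
      by (simp only: const_simps power_add power_mult)
    then have "ev \<tau> (mon d b) = \<iota> (\<tau> ^ (b mod 2 + 2 * (b div 2))) *
        x ^ (d - (b + 1) div 2 + b mod 2 + b div 2)"
      by (simp only: mon_def ev_simps power_mult_distrib power_add ac_simps)
    moreover have "d - (b + 1) div 2 + b mod 2 + b div 2 = d" "b mod 2 + 2 * (b div 2) = b"
      using that by presburger+
    ultimately show ?thesis by metis
  qed
  have "ev \<tau> (hlift d f) = (\<Sum>b\<le>2 * d. \<iota> (coeff f b * \<tau> ^ b) * x ^ d)"
    unfolding hlift_def ring_hom_simps[OF hom_ev]
    by (intro sum.cong) (auto simp: * ev_const const_simps mult.assoc)
  also have "\<dots> = \<iota> (\<Sum>b\<le>2 * d. coeff f b * \<tau> ^ b) * x ^ d"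
    by (simp add: const_simps sum_distrib_right)
  also have "(\<Sum>b\<le>2 * d. coeff f b * \<tau> ^ b) = poly f \<tau>"
    unfolding poly_altdef
    by (rule sum.mono_neutral_right) (use assms in \<open>auto simp: coeff_eq_0\<close>)
  finally show ?thesis .
qed

lemma x_nonzero: "x \<noteq> 0"
  using Phi_x ring_hom_0[OF hom_Phi] by auto

lemma ev_Q: "ev \<tau> Q = 0"
  by (simp add: Q_def ev_simps const_simps power2_eq_square)

text \<open>The point is off the line \<open>x = 0\<close>: \<open>\<psi> \<tau> x\<close> is free
  of \<open>\<epsilon>\<close>, so cancelling \<open>x\<close> keeps the multiplicity.\<close>

lemma pt_ideal_power_colon_x:
  assumes "x * F \<in> ideal_power (pt_ideal \<tau>) m" shows "F \<in> ideal_power (pt_ideal \<tau>) m"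
proof -
  have "[:0, 1:] ^ m dvd smult x (\<psi> \<tau> F)"
    using assms by (simp add: in_pt_ideal_power_iff psi_simps)
  then have "monom 1 m dvd smult x (\<psi> \<tau> F)" by (simp add: monom_altdef)
  then have "monom 1 m dvd \<psi> \<tau> F" by (simp add: monom_1_dvd_iff' x_nonzero)
  then show ?thesis by (simp add: in_pt_ideal_power_iff monom_altdef)
qed

text \<open>The conic is smooth at the point, so \<open>Q\<close> has multiplicity exactly one
  there.\<close>

lemma psi_Q:
  obtains q where "\<psi> \<tau> Q = [:0, 1:] * q" and "poly q 0 \<noteq> 0"
proof
  define u w where "u = y - \<iota> \<tau> * x" and "w = z - \<iota> (\<tau>\<^sup>2) * x"
  let ?q = "[:x * (w - (\<iota> \<tau> * u + \<iota> \<tau> * u)), - (u\<^sup>2):]"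
  have "\<psi> \<tau> Q = [:x:] * [:\<iota> (\<tau>\<^sup>2) * x, w:] - [:\<iota> \<tau> * x, u:]\<^sup>2"
    by (simp only: Q_def ring_hom_simps[OF hom_psi] psi_x psi_y psi_z u_def w_def)
  then show "\<psi> \<tau> Q = [:0, 1:] * ?q"
    by (simp add: const_simps algebra_simps power2_eq_square)
  \<comment> \<open>The form \<open>w - 2 \<tau> u\<close> is the tangent line at the point. It is
    nonzero because its restriction to the conic is the square of \<open>t - \<tau>\<close>, in
    every characteristic.\<close>
  have "\<Phi> 2 = [:[:2:]:]"
    using ring_hom_add[OF hom_Phi, of 1 1] by (simp add: ring_hom_1[OF hom_Phi] numeral_poly)
  then have "\<Phi> (w - (\<iota> \<tau> * u + \<iota> \<tau> * u)) = [:0, [:- \<tau>, 1:] ^ 2:]"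
    by (simp add: u_def w_def Phi_simps algebra_simps power2_eq_square)
  then have "w - (\<iota> \<tau> * u + \<iota> \<tau> * u) \<noteq> 0"
    using ring_hom_0[OF hom_Phi] by auto
  then show "poly ?q 0 \<noteq> 0" using x_nonzero by auto
qed

lemma Q_nonzero: "Q \<noteq> 0"
  using psi_Q[of 0] ring_hom_0[OF hom_psi, of 0] by (metis mult_eq_0_iff pCons_eq_0_iff poly_0 zero_neq_one)

text \<open>Cancelling \<open>Q\<close> lowers the multiplicity by at most one, since
  \<open>\<psi> \<tau> Q\<close> contains \<open>\<epsilon>\<close> exactly once. This drives the
  descent in \<open>symb_subset\<close>.\<close>

lemma pt_ideal_power_colon_Q:
  assumes "Q * F \<in> ideal_power (pt_ideal \<tau>) (Suc m)" shows "F \<in> ideal_power (pt_ideal \<tau>) m"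
proof (cases "\<psi> \<tau> F = 0")
  case True
  then show ?thesis by (simp add: in_pt_ideal_power_iff)
next
  case False
  obtain q where Q: "\<psi> \<tau> Q = [:0, 1:] * q" and q: "poly q 0 \<noteq> 0"
    by (rule psi_Q)
  have ord: "order 0 q = 0" using q by (simp add: order_root)
  have "[:0, 1:] * [:0, 1:] ^ m dvd [:0, 1:] * (q * \<psi> \<tau> F)"
    using assms by (simp only: in_pt_ideal_power_iff ring_hom_mult[OF hom_psi] Q mult.assoc power_Suc)
  then have dvd: "[:- 0, 1:] ^ m dvd q * \<psi> \<tau> F"
    by (subst (asm) dvd_mult_cancel_left) auto
  have nz: "q * \<psi> \<tau> F \<noteq> 0" using q False by auto
  have "order 0 (q * \<psi> \<tau> F) = order 0 (\<psi> \<tau> F)"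
    using order_mult[OF nz, of 0] ord by linarith
  then have "[:- 0, 1:] ^ m dvd \<psi> \<tau> F"
    using dvd nz False by (simp only: order_divides)
  then show ?thesis by (simp add: in_pt_ideal_power_iff)
qed

end

section \<open>An odd number of points on the conic\<close>

lemma poly_sum_monom_coeff:
  fixes p :: "'c::comm_ring_1 poly"
  shows "(\<Sum>d\<le>degree p. monom (coeff p d) d) = p"
  using poly_as_sum_of_monoms[of p] by simp

locale odd_points_on_conic = parametrized_conic \<iota> x y z \<Phi> \<psi>
  for \<iota> :: "'a::field \<Rightarrow> 'r::idom" and x y z :: 'r and \<Phi> \<psi> +
  fixes T :: "'a set" and k :: nat
  assumes finite_T: "finite T" and card_T: "card T = 2 * k + 1" and k_ge: "k \<ge> 2"
begin

definition symb :: "nat \<Rightarrow> 'r set" where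
  "symb m = (\<Inter>\<tau>\<in>T. ideal_power (pt_ideal \<tau>) m)"

abbreviation I :: "'r set" where "I \<equiv> \<Inter>\<tau>\<in>T. pt_ideal \<tau>"
abbreviation M :: "'r set" where "M \<equiv> ideal_gen {x, y, z}"

definition g :: "'a poly" where "g = (\<Prod>\<tau>\<in>T. [:- \<tau>, 1:])"
definition g1 :: "'a poly" where "g1 = poly_shift 1 g"
text \<open>With \<open>g = coeff g 0 + t g1\<close>, the forms \<open>a\<close> and
  \<open>b\<close> lift the two pieces to degree \<open>k\<close>. On the conic \<open>x\<close>,
  \<open>y\<close>, \<open>z\<close> become \<open>1\<close>, \<open>t\<close>,
  \<open>t ^ 2\<close>, so \<open>x a + y b\<close> and \<open>y a + z b\<close> restrict to
  \<open>g\<close> and \<open>t g\<close>.\<close>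

definition a :: 'r where "a = hlift k [:coeff g 0:]"
definition b :: 'r where "b = hlift k g1"
definition F1 :: 'r where "F1 = x * a + y * b"
definition F2 :: 'r where "F2 = y * a + z * b"
text \<open>
  \<open>x a\<^sup>2 + 2 y a b + z b\<^sup>2\<close> already restricts to \<open>g\<^sup>2\<close>, but \<open>x\<close> times it is \<open>F1\<^sup>2 + Q b\<^sup>2\<close>, which has
  multiplicity one at the points; the multiple \<open>Q H\<close> of \<open>Q\<close> is chosen so that \<open>b\<^sup>2 + x H\<close> vanishes
  there.
\<close>

definition h :: "'a poly" where "h = (- (g1\<^sup>2)) mod g"
definition H :: 'r where "H = hlift (2 * k - 1) h"
definition G :: 'r where "G = x * a\<^sup>2 + 2 * y * a * b + z * b\<^sup>2 + Q * H"

section \<open>Degrees and restrictions of the generators\<close>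

lemma degree_g: "degree g = 2 * k + 1"
  using finite_T card_T unfolding g_def by (subst degree_prod_eq_sum_degree) auto

lemma g_split: "pCons (coeff g 0) g1 = g"
  unfolding g1_def by (rule poly_shift_split)

lemma degree_g1: "degree g1 \<le> 2 * k"
  using degree_poly_shift_1[of g] by (simp add: g1_def degree_g)

text \<open>Reduction modulo \<open>g\<close> is essential: \<open>g1 ^ 2\<close> may have degree
  \<open>4 * k\<close>, too large for a lift in degree \<open>2 * k - 1\<close>.\<close>

lemma degree_h: "degree h \<le> 2 * (2 * k - 1)"
proof -
  have "degree h < degree g \<or> h = 0"
    unfolding h_def using degree_mod_less'[of g] degree_g by (metis degree_0 Suc_eq_plus1 nat.distinct(1))
  then show ?thesis using degree_g k_ge by auto
qed

lemma poly_g_0: "\<tau> \<in> T \<Longrightarrow> poly g \<tau> = 0"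
  using finite_T by (auto simp: g_def poly_prod)

lemma poly_g_split: "poly g \<tau> = coeff g 0 + \<tau> * poly g1 \<tau>"
  using g_split by (metis poly_pCons)

lemma poly_h: "\<tau> \<in> T \<Longrightarrow> poly h \<tau> = - (poly g1 \<tau>)\<^sup>2"
  using poly_g_0[of \<tau>] unfolding h_def by (simp add: poly_mod)

lemma Phi_a: "\<Phi> a = monom [:coeff g 0:] k" and Phi_b: "\<Phi> b = monom g1 k"
  unfolding a_def b_def using degree_g1 by (auto intro!: Phi_hlift)

lemma Phi_xyz: "\<Phi> x = monom 1 1" "\<Phi> y = monom [:0, 1:] 1" "\<Phi> z = monom ([:0, 1:]\<^sup>2) 1"
  by (simp_all add: Phi_simps monom_altdef power2_eq_square)

lemma g_eq: "g = [:coeff g 0:] + [:0, 1:] * g1"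
  by (subst g_split[symmetric]) simp

lemma Phi_F1: "\<Phi> F1 = monom g (Suc k)"
  by (subst g_eq) (simp add: F1_def ring_hom_simps[OF hom_Phi] Phi_a Phi_b Phi_xyz mult_monom add_monom)

lemma Phi_F2: "\<Phi> F2 = monom ([:0, 1:] * g) (Suc k)"
  by (subst g_eq) (simp add: F2_def ring_hom_simps[OF hom_Phi] Phi_a Phi_b Phi_xyz mult_monom
      add_monom power2_eq_square distrib_left)

text \<open>The first three terms of \<open>G\<close> restrict to the square of
  \<open>coeff g 0 + t g1\<close>, and the correction \<open>Q * H\<close> restricts to 0.\<close>

lemma Phi_G: "\<Phi> G = monom (g\<^sup>2) (2 * k + 1)"
proof -
  have two: "\<Phi> 2 = monom 2 0"
    using ring_hom_add[OF hom_Phi, of 1 1] by (simp add: ring_hom_1[OF hom_Phi] numeral_poly monom_altdef)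
  define c where "c = [:coeff g 0:]"
  have "g\<^sup>2 = c\<^sup>2 + 2 * [:0, 1:] * c * g1 + [:0, 1:]\<^sup>2 * g1\<^sup>2"
    by (subst g_eq) (simp only: c_def[symmetric] power2_eq_square mult_2 algebra_simps)
  moreover have "monom 1 1 * (monom c k)\<^sup>2 = monom (c\<^sup>2) (2 * k + 1)"
    "monom 2 0 * monom [:0, 1:] 1 * monom c k * monom g1 k = monom (2 * [:0, 1:] * c * g1) (2 * k + 1)"
    "monom ([:0, 1:]\<^sup>2) 1 * (monom g1 k)\<^sup>2 = monom ([:0, 1:]\<^sup>2 * g1\<^sup>2) (2 * k + 1)"
    unfolding mult_monom monom_power by (rule arg_cong2[where f = monom]; simp)+
  moreover have "\<Phi> G = monom 1 1 * (monom c k)\<^sup>2 + monom 2 0 * monom [:0, 1:] 1 * monom c k * monom g1 k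
      + monom ([:0, 1:]\<^sup>2) 1 * (monom g1 k)\<^sup>2 + 0 * \<Phi> H"
    by (simp only: G_def ring_hom_simps[OF hom_Phi] Phi_Q Phi_a Phi_b Phi_xyz two c_def)
  ultimately show ?thesis
    by (simp only: add_monom mult_zero_left add_0_right)
qed

section \<open>Vanishing of the generators at the points\<close>

lemma ev_a: "ev \<tau> a = \<iota> (coeff g 0) * x ^ k" and ev_b: "ev \<tau> b = \<iota> (poly g1 \<tau>) * x ^ k"
  and ev_H: "ev \<tau> H = \<iota> (poly h \<tau>) * x ^ (2 * k - 1)"
  using degree_g1 degree_h by (simp_all add: a_def b_def H_def ev_hlift)

lemma x_ev_H: "x * ev \<tau> H = \<iota> (poly h \<tau>) * x ^ (2 * k)"
proof -
  have "2 * k = Suc (2 * k - 1)" using k_ge by simp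
  then show ?thesis by (metis ev_H mult.left_commute power_Suc)
qed

lemma coeff_g_0: "\<tau> \<in> T \<Longrightarrow> coeff g 0 = - (\<tau> * poly g1 \<tau>)"
  using poly_g_split[of \<tau>] poly_g_0[of \<tau>] by (simp add: eq_neg_iff_add_eq_0)

lemma is_ideal_I: "is_ideal I"
  by (intro is_ideal_INT is_ideal_pt_ideal)

lemma is_ideal_symb: "is_ideal (symb m)"
  unfolding symb_def by (intro is_ideal_INT is_ideal_ideal_power)

lemma symb_1: "symb 1 = I"
  unfolding symb_def ideal_power_1[OF is_ideal_pt_ideal] ..

lemma in_I_iff: "F \<in> I \<longleftrightarrow> (\<forall>\<tau>\<in>T. ev \<tau> F = 0)"
  by (simp add: in_pt_ideal_iff)

lemma symb_mult: "F \<in> symb m \<Longrightarrow> F' \<in> symb n \<Longrightarrow> F * F' \<in> symb (m + n)"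
  by (auto simp: symb_def intro: ideal_power_add)

lemma symb_power: "F \<in> symb m \<Longrightarrow> F ^ j \<in> symb (m * j)"
  by (auto simp: symb_def intro: ideal_power_power)

lemma Q_in_I: "Q \<in> I"
  unfolding in_I_iff by (simp add: ev_Q)

lemma F1_in_I: "F1 \<in> I" and F2_in_I: "F2 \<in> I"
  unfolding in_I_iff
  by (simp_all add: F1_def F2_def ev_simps ev_a ev_b coeff_g_0 const_simps power2_eq_square)

text \<open>At a point of \<open>T\<close> one has \<open>coeff g 0 = - \<tau> g1(\<tau>)\<close>
  and \<open>h(\<tau>) = - g1(\<tau>)^2\<close>. Substituting both cancels the two terms of each
  expression.\<close>

lemma cofactors_in_I: "b\<^sup>2 + x * H \<in> I" "y * H - a * b \<in> I" "a\<^sup>2 + z * H \<in> I"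
proof -
  have *: "ev \<tau> (b\<^sup>2 + x * H) = 0 \<and> ev \<tau> (y * H - a * b) = 0 \<and> ev \<tau> (a\<^sup>2 + z * H) = 0"
    if "\<tau> \<in> T" for \<tau>
  proof -
    have "x ^ (2 * k) = x ^ k * x ^ k" by (simp add: mult_2 power_add)
    then have H: "x * ev \<tau> H = - (\<iota> (poly g1 \<tau>))\<^sup>2 * x ^ k * x ^ k"
      using x_ev_H[of \<tau>] poly_h[OF that] by (simp add: const_simps)
    have a: "ev \<tau> a = - (\<iota> \<tau> * \<iota> (poly g1 \<tau>)) * x ^ k"
      using ev_a[of \<tau>] coeff_g_0[OF that] by (simp add: const_simps)
    show ?thesis
      by (simp add: ev_simps ev_b a H const_simps mult.assoc)
         (simp add: algebra_simps power2_eq_square)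
  qed
  then show "b\<^sup>2 + x * H \<in> I" "y * H - a * b \<in> I" "a\<^sup>2 + z * H \<in> I"
    unfolding in_I_iff by auto
qed

text \<open>These identities write each coordinate times \<open>G\<close> as a sum of products of
  two elements of \<open>I\<close>, although \<open>G\<close> itself is not written in this
  way.\<close>

lemma x_G: "x * G = F1\<^sup>2 + Q * (b\<^sup>2 + x * H)"
  and y_G: "y * G = F1 * F2 + Q * (y * H - a * b)"
  and z_G: "z * G = F2\<^sup>2 + Q * (a\<^sup>2 + z * H)"
  by (simp_all add: G_def F1_def F2_def Q_def power2_eq_square algebra_simps)

lemma G_decomp: "G = a * F1 + b * F2 + Q * H"
  by (simp add: G_def F1_def F2_def power2_eq_square algebra_simps)

text \<open>By \<open>x_G\<close> the product \<open>x * G\<close> has multiplicity two, and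
  \<open>x\<close> can be cancelled since it vanishes at none of the points.\<close>

lemma G_in_symb_2: "G \<in> symb 2"
proof -
  have "F1 * F1 \<in> symb (1 + 1)" "Q * (b\<^sup>2 + x * H) \<in> symb (1 + 1)"
    by (intro symb_mult; simp only: symb_1 F1_in_I Q_in_I cofactors_in_I)+
  then have "x * G \<in> symb 2"
    unfolding x_G power2_eq_square[of F1] by (metis ideal_add is_ideal_symb one_add_one)
  then show ?thesis
    by (auto simp: symb_def intro: pt_ideal_power_colon_x)
qed

section \<open>Decomposition of the symbolic powers\<close>

lemma symb_colon_Q: "Q * F \<in> symb (Suc m) \<Longrightarrow> F \<in> symb m"
  by (auto simp: symb_def intro: pt_ideal_power_colon_Q)

text \<open>The degree bound is Bezout's count: a form of degree \<open>d\<close> meets the conic in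
  at most \<open>2 * d\<close> points with multiplicity, unless it restricts to 0.\<close>

lemma symb_Phi:
  assumes "F \<in> symb m"
  obtains q where "\<And>d. coeff (\<Phi> F) d = g ^ m * q d"
    and "\<And>d. q d \<noteq> 0 \<Longrightarrow> m * (2 * k + 1) + degree (q d) \<le> 2 * d"
proof -
  have "g ^ m dvd coeff (\<Phi> F) d" for d
    unfolding g_def
    by (rule prod_linear_powers_dvd[OF finite_T]) (use assms in \<open>auto simp: symb_def intro: Phi_dvd\<close>)
  then obtain q where q: "\<And>d. coeff (\<Phi> F) d = g ^ m * q d"
    unfolding dvd_def by metis
  have "m * (2 * k + 1) + degree (q d) \<le> 2 * d" if "q d \<noteq> 0" for d
  proof -
    have "g \<noteq> 0" using degree_g by auto
    then have "degree (g ^ m * q d) = m * (2 * k + 1) + degree (q d)"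
      using that by (simp add: degree_mult_eq degree_power_eq degree_g)
    moreover have "degree (g ^ m * q d) \<le> 2 * d"
      using Phi_in_cone[of F] by (simp add: cone_def q[symmetric])
    ultimately show ?thesis by simp
  qed
  with q show ?thesis using that by blast
qed

text \<open>Here \<open>G ^ j\<close> has degree \<open>N\<close>, exactly half of the degree of
  \<open>g ^ (2 * j)\<close>, so the quotient lifts in degree \<open>d - N\<close>. Then
  \<open>F\<close> and \<open>G ^ j * L\<close> have the same restriction.\<close>

lemma symb_even_decomp:
  assumes "F \<in> symb (2 * j)"
  obtains L where "Q dvd F - G ^ j * L"
proof -
  obtain q where q: "\<And>d. coeff (\<Phi> F) d = g ^ (2 * j) * q d"
    and deg: "\<And>d. q d \<noteq> 0 \<Longrightarrow> 2 * j * (2 * k + 1) + degree (q d) \<le> 2 * d"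
    using symb_Phi[OF assms] by metis
  define N where "N = (2 * k + 1) * j"
  define L where "L = (\<Sum>d\<le>degree (\<Phi> F). hlift (d - N) (q d))"
  have "\<Phi> (G ^ j * hlift (d - N) (q d)) = monom (coeff (\<Phi> F) d) d" for d
  proof (cases "q d = 0")
    case True
    then show ?thesis by (simp add: q hlift_0 ring_hom_0[OF hom_Phi])
  next
    case False
    then have d: "degree (q d) \<le> 2 * (d - N)" "N + (d - N) = d"
      using deg[of d] by (auto simp: N_def algebra_simps)
    have "\<Phi> (G ^ j) = monom (g ^ (2 * j)) N"
      by (simp add: ring_hom_simps[OF hom_Phi] Phi_G monom_power power_mult N_def del: mult_Suc)
    then show ?thesis
      using d by (simp add: ring_hom_mult[OF hom_Phi] Phi_hlift mult_monom q)
  qed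
  then have "\<Phi> (G ^ j * L) = (\<Sum>d\<le>degree (\<Phi> F). monom (coeff (\<Phi> F) d) d)"
    by (simp only: L_def sum_distrib_left ring_hom_sum[OF hom_Phi])
  then have "\<Phi> (F - G ^ j * L) = 0"
    by (simp add: ring_hom_diff[OF hom_Phi] poly_sum_monom_coeff)
  then show ?thesis using that kernel_Phi by blast
qed

text \<open>The degree of \<open>g ^ (2 * j + 1)\<close> is odd, so the quotient may exceed the
  liftable degree \<open>2 * (d - N)\<close> by one. It is split into its constant term, paired with
  \<open>F1\<close>, and \<open>t\<close> times the rest, paired with \<open>F2\<close>.\<close>

lemma symb_odd_decomp:
  assumes "F \<in> symb (2 * j + 1)"
  obtains L1 L2 where "Q dvd F - G ^ j * (F1 * L1 + F2 * L2)"
proof -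
  obtain q where q: "\<And>d. coeff (\<Phi> F) d = g ^ (2 * j + 1) * q d"
    and deg: "\<And>d. q d \<noteq> 0 \<Longrightarrow> (2 * j + 1) * (2 * k + 1) + degree (q d) \<le> 2 * d"
    using symb_Phi[OF assms] by metis
  define N where "N = (2 * k + 1) * j + Suc k"
  define l1 where "l1 d = hlift (d - N) [:coeff (q d) 0:]" for d
  define l2 where "l2 d = hlift (d - N) (poly_shift 1 (q d))" for d
  define L1 where "L1 = (\<Sum>d\<le>degree (\<Phi> F). l1 d)"
  define L2 where "L2 = (\<Sum>d\<le>degree (\<Phi> F). l2 d)"
  have "\<Phi> (G ^ j * (F1 * l1 d + F2 * l2 d)) = monom (coeff (\<Phi> F) d) d" for d
  proof (cases "q d = 0")
    case True
    then show ?thesis by (simp add: q l1_def l2_def hlift_0 ring_hom_0[OF hom_Phi])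
  next
    case False
    have "2 * N = (2 * j + 1) * (2 * k + 1) + 1" by (simp add: N_def algebra_simps)
    then have "degree (q d) - 1 \<le> 2 * (d - N)" and d: "N + (d - N) = d"
      using deg[OF False] by linarith+
    then have "degree (poly_shift 1 (q d)) \<le> 2 * (d - N)"
      using degree_poly_shift_1 order.trans by blast
    then have l: "\<Phi> (l1 d) = monom [:coeff (q d) 0:] (d - N)"
        "\<Phi> (l2 d) = monom (poly_shift 1 (q d)) (d - N)"
      unfolding l1_def l2_def by (simp_all add: Phi_hlift)
    have "g * [:coeff (q d) 0:] + [:0, 1:] * g * poly_shift 1 (q d) =
        g * ([:coeff (q d) 0:] + [:0, 1:] * poly_shift 1 (q d))"
      by (simp only: distrib_left mult.assoc mult.left_commute)
    also have "[:coeff (q d) 0:] + [:0, 1:] * poly_shift 1 (q d) = pCons (coeff (q d) 0) (poly_shift 1 (q d))"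
      by simp
    finally have split: "g * [:coeff (q d) 0:] + [:0, 1:] * g * poly_shift 1 (q d) = g * q d"
      by (simp only: poly_shift_split)
    have G: "\<Phi> (G ^ j) = monom (g ^ (2 * j)) ((2 * k + 1) * j)"
      by (simp add: ring_hom_simps[OF hom_Phi] Phi_G monom_power power_mult del: mult_Suc)
    have "\<Phi> (F1 * l1 d + F2 * l2 d) = monom (g * q d) (Suc k + (d - N))"
      by (simp only: ring_hom_simps[OF hom_Phi] Phi_F1 Phi_F2 l mult_monom add_monom split)
    then have "\<Phi> (G ^ j * (F1 * l1 d + F2 * l2 d)) = monom (g ^ (2 * j) * (g * q d)) (N + (d - N))"
      by (simp only: ring_hom_mult[OF hom_Phi] G mult_monom N_def add.assoc)
    then show ?thesis by (simp add: d q ac_simps)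
  qed
  moreover have "G ^ j * (F1 * L1 + F2 * L2) = (\<Sum>d\<le>degree (\<Phi> F). G ^ j * (F1 * l1 d + F2 * l2 d))"
    by (simp add: L1_def L2_def sum_distrib_left distrib_left sum.distrib)
  ultimately have "\<Phi> (G ^ j * (F1 * L1 + F2 * L2)) = (\<Sum>d\<le>degree (\<Phi> F). monom (coeff (\<Phi> F) d) d)"
    by (simp only: ring_hom_sum[OF hom_Phi])
  then have "\<Phi> (F - G ^ j * (F1 * L1 + F2 * L2)) = 0"
    by (simp add: ring_hom_diff[OF hom_Phi] poly_sum_monom_coeff)
  then show ?thesis using that kernel_Phi by blast
qed

text \<open>Induction on \<open>m\<close>: the decompositions leave a remainder
  \<open>Q * F'\<close> in \<open>symb (Suc m)\<close>, and \<open>symb_colon_Q\<close> puts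
  \<open>F'\<close> in \<open>symb m\<close>.\<close>

lemma symb_subset:
  assumes ideal: "\<And>m. is_ideal (J m)" and J0: "J 0 = UNIV"
    and G: "\<And>j. G ^ j \<in> J (2 * j)"
    and F: "\<And>j. G ^ j * F1 \<in> J (2 * j + 1)" "\<And>j. G ^ j * F2 \<in> J (2 * j + 1)"
    and QJ: "\<And>m f. f \<in> J m \<Longrightarrow> Q * f \<in> J (Suc m)"
  shows "symb m \<subseteq> J m"
proof (induction m)
  case 0
  then show ?case by (simp add: J0)
next
  case (Suc m)
  have step: "F \<in> J (Suc m)"
    if "F \<in> symb (Suc m)" "Q dvd F - L" "L \<in> symb (Suc m)" "L \<in> J (Suc m)" for F L
  proof -
    obtain F' where F': "F - L = Q * F'" using \<open>Q dvd F - L\<close> by (elim dvdE)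
    have "Q * F' \<in> symb (Suc m)"
      unfolding F'[symmetric] using that by (intro ideal_diff is_ideal_symb)
    then have "F' \<in> J m" using symb_colon_Q Suc.IH by blast
    then have "L + Q * F' \<in> J (Suc m)" by (intro ideal_add ideal QJ that)
    then show ?thesis by (simp add: F'[symmetric])
  qed
  have Gj: "G ^ j \<in> symb (2 * j)" for j by (rule symb_power[OF G_in_symb_2])
  show ?case
  proof
    fix F assume F_in: "F \<in> symb (Suc m)"
    show "F \<in> J (Suc m)"
    proof (cases "even (Suc m)")
      case True
      then obtain j where j: "Suc m = 2 * j" by (elim evenE)
      obtain L where "Q dvd F - G ^ j * L" using symb_even_decomp F_in j by metis
      then show ?thesis
        by (rule step[OF F_in]) (simp_all add: j G Gj ideal ideal_mult_right is_ideal_symb)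
    next
      case False
      then obtain j where j: "Suc m = 2 * j + 1" by (elim oddE)
      obtain L1 L2 where L: "Q dvd F - G ^ j * (F1 * L1 + F2 * L2)"
        using symb_odd_decomp F_in j by metis
      have eq: "G ^ j * (F1 * L1 + F2 * L2) = (G ^ j * F1) * L1 + (G ^ j * F2) * L2"
        by (simp add: distrib_left mult.assoc)
      have "G ^ j * F1 \<in> symb (2 * j + 1)" "G ^ j * F2 \<in> symb (2 * j + 1)"
        using F1_in_I F2_in_I by (auto simp only: symb_1[symmetric] intro!: symb_mult Gj)
      moreover have "is_ideal (symb (2 * j + 1))" "is_ideal (J (2 * j + 1))"
        by (rule is_ideal_symb ideal)+
      ultimately have "G ^ j * F1 * L1 + G ^ j * F2 * L2 \<in> symb (Suc m)"
          "G ^ j * F1 * L1 + G ^ j * F2 * L2 \<in> J (Suc m)"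
        using F[of j] unfolding j by (blast intro: ideal_add ideal_mult_right)+
      then show ?thesis
        using step[OF F_in] L unfolding eq by blast
    qed
  qed
qed

end

section \<open>Containments in powers of \<open>I\<close> and \<open>M\<close>\<close>

context odd_points_on_conic
begin

lemma is_ideal_M: "is_ideal M"
  by (rule is_ideal_ideal_gen)

lemma variables_in_M: "x \<in> M" "y \<in> M" "z \<in> M"
  by (auto intro: ideal_gen_superset)

lemma hlift_in_M_power: "hlift d f \<in> ideal_power M d"
  unfolding hlift_def
proof (intro ideal_sum is_ideal_ideal_power ideal_mult_left)
  fix b assume "b \<in> {..2 * d}"
  then have "b \<le> 2 * d" by simp
  then have "d - (b + 1) div 2 + b mod 2 + b div 2 = d" by presburger
  moreover have "mon d b \<in> ideal_power M (d - (b + 1) div 2 + b mod 2 + b div 2)"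
    unfolding mon_def by (intro ideal_power_add ideal_power_base variables_in_M)
  ultimately show "mon d b \<in> ideal_power M d" by simp
qed

lemma M_power_subset_M: "d \<ge> 1 \<Longrightarrow> ideal_power M d \<subseteq> M"
  using ideal_power_antimono[of 1 d M] ideal_power_1[OF is_ideal_M] by simp

lemma coefficients_in_M: "a \<in> M" "b \<in> M" "H \<in> M"
  unfolding a_def b_def H_def
  using M_power_subset_M[of k] M_power_subset_M[of "2 * k - 1"] k_ge hlift_in_M_power by fastforce+

lemma Q_in_M2: "Q \<in> ideal_power M 2"
proof -
  have "x * z \<in> ideal_power M (1 + 1)" "y * y \<in> ideal_power M (1 + 1)"
    by (intro ideal_power_add; simp only: ideal_power_1[OF is_ideal_M] variables_in_M)+
  then show ?thesis
    unfolding Q_def power2_eq_square[of y] by (metis ideal_diff is_ideal_ideal_power one_add_one)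
qed

lemma F_in_M2: "F1 \<in> ideal_power M 2" "F2 \<in> ideal_power M 2"
proof -
  have *: "v * w \<in> ideal_power M (1 + 1)" if "v \<in> {x, y, z}" "w \<in> {a, b}" for v w
    using that by (intro ideal_power_add)
      (auto simp only: ideal_power_1[OF is_ideal_M] variables_in_M coefficients_in_M insert_iff empty_iff)
  show "F1 \<in> ideal_power M 2" "F2 \<in> ideal_power M 2"
    unfolding F1_def F2_def one_add_one[symmetric]
    by (intro ideal_add is_ideal_ideal_power *; simp)+
qed

text \<open>The form \<open>G\<close> has degree \<open>2 * k + 1\<close>, and
  \<open>k \<ge> 2\<close> makes this at least 4, twice its multiplicity.\<close>

lemma G_in_M4: "G \<in> ideal_power M 4"
proof -
  have a: "a \<in> ideal_power M k" "b \<in> ideal_power M k" "H \<in> ideal_power M (2 * k - 1)"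
    unfolding a_def b_def H_def by (rule hlift_in_M_power)+
  have "4 \<le> 1 + (k + k)" "4 \<le> 2 + (2 * k - 1)" using k_ge by simp_all
  then have sub: "ideal_power M (1 + (k + k)) \<subseteq> ideal_power M 4"
      "ideal_power M (2 + (2 * k - 1)) \<subseteq> ideal_power M 4"
    by (blast intro!: ideal_power_antimono)+
  have *: "v * (w * w') \<in> ideal_power M 4" if "v \<in> M" "w \<in> {a, b}" "w' \<in> {a, b}" for v w w'
  proof -
    have "v * (w * w') \<in> ideal_power M (1 + (k + k))"
      by (intro ideal_power_add) (use that a ideal_power_1[OF is_ideal_M] in auto)
    with sub show ?thesis by blast
  qed
  have "Q * H \<in> ideal_power M 4"
    using ideal_power_add[OF Q_in_M2 a(3)] sub by blast
  moreover have "G = x * (a * a) + 2 * (y * (a * b)) + z * (b * b) + Q * H"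
    by (simp add: G_def power2_eq_square mult.assoc)
  moreover have "x * (a * a) \<in> ideal_power M 4" "y * (a * b) \<in> ideal_power M 4"
    "z * (b * b) \<in> ideal_power M 4"
    by (rule *; simp add: variables_in_M)+
  ultimately show ?thesis
    by (metis ideal_add ideal_mult_left is_ideal_ideal_power)
qed

lemma G_in_MI: "G \<in> ideal_mult (ideal_power M 1) (ideal_power I 1)"
  unfolding ideal_power_1[OF is_ideal_M] ideal_power_1[OF is_ideal_I] G_decomp
  unfolding mult.commute[of Q]
  by (intro ideal_add is_ideal_ideal_mult ideal_mult_I coefficients_in_M F1_in_I F2_in_I Q_in_I)

text \<open>It suffices to take \<open>v\<close> among the coordinates, where \<open>x_G\<close>,
  \<open>y_G\<close> and \<open>z_G\<close> apply.\<close>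

lemma M_G_in_I2: "v \<in> M \<Longrightarrow> v * G \<in> ideal_power I 2"
proof -
  have prod: "f * f' \<in> ideal_power I 2" if "f \<in> I" "f' \<in> I" for f f'
    using ideal_power_add[of f I 1 f' 1] that unfolding ideal_power_1[OF is_ideal_I] one_add_one .
  have "{x, y, z} \<subseteq> {v. v * G \<in> ideal_power I 2}"
    unfolding insert_subset mem_Collect_eq x_G y_G z_G power2_eq_square[of F1] power2_eq_square[of F2]
    by (intro conjI ideal_add is_ideal_ideal_power prod F1_in_I F2_in_I Q_in_I cofactors_in_I empty_subsetI)
  then have "M \<subseteq> {v. v * G \<in> ideal_power I 2}"
    by (intro ideal_gen_minimal is_ideal_colon is_ideal_ideal_power)
  then show "v \<in> M \<Longrightarrow> v * G \<in> ideal_power I 2" by blast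
qed

lemma G_in_I: "G \<in> I"
  unfolding G_decomp
  by (intro ideal_add is_ideal_I ideal_mult_left ideal_mult_right F1_in_I F2_in_I Q_in_I)

text \<open>One factor is expanded by \<open>G_decomp\<close>. Its coefficients lie in
  \<open>M\<close>, so each of them times the other factor lies in the square of
  \<open>I\<close>.\<close>

lemma G2_in_I3: "G\<^sup>2 \<in> ideal_power I 3"
proof -
  have *: "f * (v * G) \<in> ideal_power I 3" if "f \<in> I" "v \<in> M" for f v
    using ideal_mult_I[OF that(1) M_G_in_I2[OF that(2)]] by (simp add: eval_nat_numeral)
  have "G\<^sup>2 = F1 * (a * G) + F2 * (b * G) + Q * (H * G)"
    unfolding power2_eq_square by (subst (1) G_decomp) (simp add: algebra_simps)
  then show ?thesis
    by (simp only:) (intro ideal_add is_ideal_ideal_power * F1_in_I F2_in_I Q_in_I coefficients_in_M)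
qed

text \<open>Factors are paired by \<open>G2_in_I3\<close>; for odd \<open>j\<close> the remaining
  factor contributes one more power of \<open>I\<close>.\<close>

lemma G_power_in_I: "G ^ j \<in> ideal_power I (3 * j div 2)"
proof -
  have even: "G ^ (2 * i) \<in> ideal_power I (3 * i)" for i
    using ideal_power_power[OF G2_in_I3, of i] by (simp add: power_mult)
  show ?thesis
  proof (cases "even j")
    case True
    then obtain i where "j = 2 * i" by (elim evenE)
    then show ?thesis using even[of i] by simp
  next
    case False
    then obtain i where j: "j = 2 * i + 1" by (elim oddE)
    have "3 * j div 2 = Suc (3 * i)" unfolding j by presburger
    moreover have "G * G ^ (2 * i) \<in> ideal_power I (Suc (3 * i))"
      unfolding ideal_power.simps by (intro ideal_mult_I G_in_I even)
    ultimately show ?thesis by (simp add: j)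
  qed
qed

text \<open>The exponents are \<open>m / 2\<close> rounded down for \<open>M\<close> and rounded up
  for \<open>I\<close>. The form \<open>G\<close> has multiplicity two and raises both by
  one.\<close>

lemma symb_subset_mixed:
  "symb m \<subseteq> ideal_mult (ideal_power M (m div 2)) (ideal_power I (Suc m div 2))"
proof (rule symb_subset)
  let ?J = "\<lambda>p q. ideal_mult (ideal_power M p) (ideal_power I q)"
  have one: "1 \<in> ideal_power J 0" for J :: "'r set" by simp
  have Gj: "G ^ j \<in> ?J j j" for j
  proof (induction j)
    case 0
    then show ?case using ideal_mult_I[OF one one, of M I] by simp
  next
    case (Suc j)
    then show ?case
      using ideal_mult_powers_mult[OF G_in_MI Suc] by simp
  qed
  have single: "f \<in> ?J 0 1" if "f \<in> I" for f
    using ideal_mult_I[OF one, of f "ideal_power I 1" M] ideal_power_1[OF is_ideal_I] that by simp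
  have single': "f \<in> ?J 1 0" if "f \<in> M" for f
    using ideal_mult_I[OF _ one, of f "ideal_power M 1" I] ideal_power_1[OF is_ideal_M] that by simp
  show "is_ideal (?J (m div 2) (Suc m div 2))" for m
    by (rule is_ideal_ideal_mult)
  show "?J (0 div 2) (Suc 0 div 2) = UNIV"
    using ideal_mult_I[of _ UNIV 1 UNIV] by (auto simp: UNIV_I)
  show "G ^ j \<in> ?J (2 * j div 2) (Suc (2 * j) div 2)" for j
    using Gj by simp
  show "G ^ j * F1 \<in> ?J ((2 * j + 1) div 2) (Suc (2 * j + 1) div 2)" for j
    using ideal_mult_powers_mult[OF Gj single[OF F1_in_I]] by simp
  show "G ^ j * F2 \<in> ?J ((2 * j + 1) div 2) (Suc (2 * j + 1) div 2)" for j
    using ideal_mult_powers_mult[OF Gj single[OF F2_in_I]] by simp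
  show "Q * f \<in> ?J (Suc m div 2) (Suc (Suc m) div 2)" if "f \<in> ?J (m div 2) (Suc m div 2)" for m f
  \<comment> \<open>Passing from \<open>m\<close> to \<open>Suc m\<close> raises only one exponent:
    for even \<open>m\<close> the form \<open>Q\<close> counts as an element of \<open>I\<close>,
    for odd \<open>m\<close> as an element of \<open>M\<close>.\<close>
  proof (cases "even m")
    case True
    then have "Suc m div 2 = 0 + m div 2" "Suc (Suc m) div 2 = 1 + Suc m div 2" by presburger+
    then show ?thesis
      using ideal_mult_powers_mult[OF single[OF Q_in_I] that] by (simp only:)
  next
    case False
    then have "Suc m div 2 = 1 + m div 2" "Suc (Suc m) div 2 = 0 + Suc m div 2" by presburger+
    moreover have "Q \<in> M" using Q_in_M2 M_power_subset_M[of 2] by auto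
    ultimately show ?thesis
      using ideal_mult_powers_mult[OF single' that] by (simp only:)
  qed
qed

text \<open>The rate 3/4 comes from \<open>G\<^sup>2\<close>, which has multiplicity 4 and lies in
  the cube of \<open>I\<close>. The forms \<open>F1\<close>, \<open>F2\<close> and \<open>Q\<close>
  gain a full power of \<open>I\<close> for multiplicity one, which absorbs the rounding.\<close>

lemma symb_subset_I_power: "symb m \<subseteq> ideal_power I (3 * m div 4)"
proof (rule symb_subset)
  show "is_ideal (ideal_power I (3 * m div 4))" for m
    by (rule is_ideal_ideal_power)
  show "ideal_power I (3 * 0 div 4) = UNIV" by simp
  show "G ^ j \<in> ideal_power I (3 * (2 * j) div 4)" for j
    using G_power_in_I[of j] by (metis mult.left_commute mult.assoc div_mult_mult1 num_double numeral_times_numeral zero_neq_numeral)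
  have *: "G ^ j * f \<in> ideal_power I (3 * (2 * j + 1) div 4)" if "f \<in> I" for j f
  proof -
    have "f * G ^ j \<in> ideal_power I (Suc (3 * j div 2))"
      unfolding ideal_power.simps by (intro ideal_mult_I that G_power_in_I)
    moreover have "3 * (2 * j + 1) div 4 \<le> Suc (3 * j div 2)" by presburger
    ultimately have "f * G ^ j \<in> ideal_power I (3 * (2 * j + 1) div 4)"
      using ideal_power_antimono by blast
    then show ?thesis by (simp only: mult.commute)
  qed
  show "G ^ j * F1 \<in> ideal_power I (3 * (2 * j + 1) div 4)" for j by (rule *[OF F1_in_I])
  show "G ^ j * F2 \<in> ideal_power I (3 * (2 * j + 1) div 4)" for j by (rule *[OF F2_in_I])
  show "Q * f \<in> ideal_power I (3 * Suc m div 4)" if "f \<in> ideal_power I (3 * m div 4)" for m f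
  proof -
    have "Q * f \<in> ideal_power I (Suc (3 * m div 4))"
      unfolding ideal_power.simps by (intro ideal_mult_I that Q_in_I)
    moreover have "3 * Suc m div 4 \<le> Suc (3 * m div 4)" by presburger
    ultimately show ?thesis using ideal_power_antimono by blast
  qed
qed

text \<open>Every generator has degree at least twice its multiplicity. This gives the lower bound
  for \<open>alpha\<close>, which \<open>Q ^ m\<close> attains.\<close>

lemma symb_subset_M_power: "symb m \<subseteq> ideal_power M (2 * m)"
proof (rule symb_subset)
  show "is_ideal (ideal_power M (2 * m))" for m
    by (rule is_ideal_ideal_power)
  show "ideal_power M (2 * 0) = UNIV" by simp
  have Gj: "G ^ j \<in> ideal_power M (2 * (2 * j))" for j
    using ideal_power_power[OF G_in_M4, of j] by simp
  then show "G ^ j \<in> ideal_power M (2 * (2 * j))" for j .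
  show "G ^ j * F1 \<in> ideal_power M (2 * (2 * j + 1))" for j
    using ideal_power_add[OF Gj F_in_M2(1)] by (simp only: distrib_left mult_1_right)
  show "G ^ j * F2 \<in> ideal_power M (2 * (2 * j + 1))" for j
    using ideal_power_add[OF Gj F_in_M2(2)] by (simp only: distrib_left mult_1_right)
  show "Q * f \<in> ideal_power M (2 * Suc m)" if "f \<in> ideal_power M (2 * m)" for m f
    using ideal_power_add[OF Q_in_M2 that] by (simp only: mult_Suc_right)
qed

lemma Q_power_in_symb: "Q ^ m \<in> symb m"
  using symb_power[of Q 1 m] Q_in_I unfolding symb_1 by simp

end

section \<open>Substitution and forms\<close>

definition const :: "'a::comm_ring_1 \<Rightarrow> 'a poly3" where
  "const c = Poly_Mapping.single 0 c"

text \<open>Evaluation at \<open>f\<close> with coefficients mapped by \<open>h\<close>;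
  \<open>eval_poly3\<close>, \<open>Phi\<close> and \<open>psi\<close> are all instances.\<close>

definition subst :: "('a::comm_ring_1 \<Rightarrow> 'r::comm_ring_1) \<Rightarrow> (3 \<Rightarrow> 'r) \<Rightarrow> 'a poly3 \<Rightarrow> 'r" where
  "subst h f F = (\<Sum>e\<in>Poly_Mapping.keys F.
      h (Poly_Mapping.lookup F e) * (\<Prod>i\<in>UNIV. f i ^ Poly_Mapping.lookup e i))"

lemma eval_poly3_eq_subst: "eval_poly3 F v = subst (\<lambda>c. c) (\<lambda>i. v $ i) F"
  by (simp add: eval_poly3_def subst_def)

lemma poly_mapping_eq_sum_single:
  "F = (\<Sum>e\<in>Poly_Mapping.keys F. Poly_Mapping.single e (Poly_Mapping.lookup F e))"
  by (rule poly_mapping_eqI)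
     (auto simp: lookup_sum lookup_single when_def in_keys_iff sum.delta)

context
  fixes h :: "'a::comm_ring_1 \<Rightarrow> 'r::comm_ring_1"
  assumes h: "is_ring_hom h"
begin

text \<open>Summing over a larger set of exponents handles cancellation in sums, where the support
  may shrink.\<close>

lemma subst_superset:
  assumes "finite S" "Poly_Mapping.keys F \<subseteq> S"
  shows "subst h f F = (\<Sum>e\<in>S. h (Poly_Mapping.lookup F e) * (\<Prod>i\<in>UNIV. f i ^ Poly_Mapping.lookup e i))"
  unfolding subst_def
  by (rule sum.mono_neutral_left) (use assms in \<open>auto simp: in_keys_iff ring_hom_0[OF h]\<close>)

lemma subst_add: "subst h f (F + G) = subst h f F + subst h f G"
proof -
  let ?S = "Poly_Mapping.keys F \<union> Poly_Mapping.keys G"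
  have "Poly_Mapping.keys (F + G) \<subseteq> ?S" by (rule Poly_Mapping.keys_add)
  then show ?thesis
    by (simp add: subst_superset[of ?S] lookup_add ring_hom_add[OF h] distrib_right sum.distrib)
qed

lemma subst_0: "subst h f 0 = 0"
  by (simp add: subst_def)

lemma subst_sum: "subst h f (sum F A) = (\<Sum>i\<in>A. subst h f (F i))"
  by (induction A rule: infinite_finite_induct) (simp_all add: subst_0 subst_add)

lemma subst_single:
  "subst h f (Poly_Mapping.single e c) = h c * (\<Prod>i\<in>UNIV. f i ^ Poly_Mapping.lookup e i)"
  by (subst subst_superset[of "{e}"]) (auto simp: lookup_single)

lemma subst_const: "subst h f (const c) = h c"
  by (simp add: const_def subst_single)

lemma subst_variable: "subst h f (variable i) = f i"
proof -
  have "(\<Prod>j\<in>UNIV. f j ^ Poly_Mapping.lookup (Poly_Mapping.single i (1::nat)) j) = (\<Prod>j\<in>UNIV. if j = i then f j else 1)"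
    by (rule prod.cong) (auto simp: lookup_single when_def)
  then show ?thesis
    by (simp add: variable_def subst_single ring_hom_1[OF h] prod.delta)
qed

lemma is_ring_hom_subst: "is_ring_hom (subst h f)"
proof -
  have mult: "subst h f (F * G) = subst h f F * subst h f G" for F G
  proof -
    let ?s = "\<lambda>F e. Poly_Mapping.single e (Poly_Mapping.lookup F e)"
    have single: "subst h f (?s F d * ?s G e) = subst h f (?s F d) * subst h f (?s G e)" for d e
      by (simp add: mult_single subst_single lookup_add power_add prod.distrib ring_hom_mult[OF h])
    have "subst h f (F * G) = subst h f ((\<Sum>d\<in>Poly_Mapping.keys F. ?s F d) * (\<Sum>e\<in>Poly_Mapping.keys G. ?s G e))"
      by (simp flip: poly_mapping_eq_sum_single)
    also have "\<dots> = (\<Sum>d\<in>Poly_Mapping.keys F. subst h f (?s F d)) * (\<Sum>e\<in>Poly_Mapping.keys G. subst h f (?s G e))"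
      by (simp only: sum_product subst_sum single)
    also have "\<dots> = subst h f F * subst h f G"
      by (simp flip: subst_sum poly_mapping_eq_sum_single)
    finally show ?thesis .
  qed
  have "subst h f 1 = 1"
    using subst_const[of f 1] by (simp add: const_def ring_hom_1[OF h])
  with mult show ?thesis
    by (simp add: is_ring_hom_def subst_0 subst_add)
qed

end

lemma is_ring_hom_const: "is_ring_hom const"
  by (simp add: is_ring_hom_def const_def single_add mult_single)

lemma is_ring_hom_id: "is_ring_hom (\<lambda>c. c)"
  by (simp add: is_ring_hom_def)

lemma single_eq_monomial:
  "Poly_Mapping.single e c = const c * (\<Prod>i\<in>UNIV. variable i ^ Poly_Mapping.lookup e i)"
proof -
  have pow: "variable i ^ n = Poly_Mapping.single (Poly_Mapping.single i n) (1::'a)" for i n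
    by (induction n) (simp_all add: variable_def mult_single flip: single_add)
  have prod: "(\<Prod>i\<in>A. Poly_Mapping.single (s i) (1::'a)) = Poly_Mapping.single (\<Sum>i\<in>A. s i) 1"
    if "finite A" for A :: "3 set" and s :: "3 \<Rightarrow> (3 \<Rightarrow>\<^sub>0 nat)"
    using that by (induction A rule: finite_induct) (simp_all add: mult_single)
  have "(\<Sum>i\<in>UNIV. Poly_Mapping.single i (Poly_Mapping.lookup e i)) = e"
    by (rule poly_mapping_eqI) (simp add: lookup_sum lookup_single when_def sum.delta)
  then show ?thesis
    by (simp add: pow prod const_def mult_single)
qed

text \<open>An induction principle for polynomials, from which the assumption
  \<open>generated\<close> of \<open>parametrized_conic\<close> is obtained.\<close>

lemma poly3_generated:
  assumes const: "\<And>c. const c \<in> S" and var: "\<And>i. variable i \<in> S"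
    and add: "\<And>F G. F \<in> S \<Longrightarrow> G \<in> S \<Longrightarrow> F + G \<in> S"
    and mult: "\<And>F G. F \<in> S \<Longrightarrow> G \<in> S \<Longrightarrow> F * G \<in> S"
  shows "F \<in> S"
proof -
  have zero: "0 \<in> S" and one: "1 \<in> S"
    using const[of 0] const[of 1] by (simp_all add: const_def)
  have power: "G ^ n \<in> S" if "G \<in> S" for G n
    using that by (induction n) (auto simp: one mult)
  have prod: "(\<Prod>i\<in>A. f i) \<in> S" if "\<And>i. f i \<in> S" for A :: "3 set" and f
    using that by (induction A rule: infinite_finite_induct) (auto simp: one mult)
  have sum: "(\<Sum>e\<in>A. f e) \<in> S" if "\<And>e. f e \<in> S" for A :: "(3 \<Rightarrow>\<^sub>0 nat) set" and f
    using that by (induction A rule: infinite_finite_induct) (auto simp: zero add)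
  show ?thesis
    by (subst poly_mapping_eq_sum_single) (auto simp: single_eq_monomial intro!: sum mult const prod power var)
qed

section \<open>Degrees of forms\<close>

lemma monom_degree_add: "monom_degree (d + e) = monom_degree d + monom_degree e"
  by (simp add: monom_degree_def lookup_add sum.distrib)

lemma is_form_add: "is_form d F \<Longrightarrow> is_form d G \<Longrightarrow> is_form d (F + G)"
  using Poly_Mapping.keys_add[of F G] by (auto simp: is_form_def)

lemma is_form_uminus: "is_form d F \<Longrightarrow> is_form d (- F)"
  by (simp add: is_form_def)

lemma is_form_sum: "(\<And>i. i \<in> A \<Longrightarrow> is_form d (F i)) \<Longrightarrow> is_form d (sum F A)"
  by (induction A rule: infinite_finite_induct) (auto simp: is_form_add, auto simp: is_form_def)

lemma is_form_mult: "is_form c F \<Longrightarrow> is_form d G \<Longrightarrow> is_form (c + d) (F * G)"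
  using keys_mult[of F G] by (fastforce simp: is_form_def monom_degree_add)

lemma is_form_const: "is_form 0 (const c)"
  by (simp add: is_form_def const_def monom_degree_def)

lemma is_form_variable: "is_form 1 (variable i)"
  by (simp add: is_form_def variable_def monom_degree_def lookup_single when_def sum.delta')

lemma is_form_power: "is_form d F \<Longrightarrow> is_form (d * m) (F ^ m)"
  using is_form_const[of 1] by (induction m) (auto simp: is_form_mult const_def)

text \<open>A description of the \<open>d\<close>-th power of the irrelevant ideal by monomials, so
  that degrees can be read off.\<close>

definition order_ge :: "nat \<Rightarrow> 'a::comm_ring_1 poly3 set" where
  "order_ge d = {F. \<forall>e\<in>Poly_Mapping.keys F. d \<le> monom_degree e}"

lemma order_ge_mult: "F \<in> order_ge c \<Longrightarrow> G \<in> order_ge d \<Longrightarrow> F * G \<in> order_ge (c + d)"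
  using keys_mult[of F G] by (fastforce simp: order_ge_def monom_degree_add)

lemma is_ideal_order_ge: "is_ideal (order_ge d)"
  using order_ge_mult[of _ 0 _ d] Poly_Mapping.keys_add
  by (fastforce simp: is_ideal_def order_ge_def)

lemma irrelevant_ideal_power_subset:
  "ideal_power (irrelevant_ideal :: 'a::comm_ring_1 poly3 set) d \<subseteq> order_ge d"
proof (induction d)
  case (Suc d)
  have "(irrelevant_ideal :: 'a poly3 set) \<subseteq> order_ge 1"
    unfolding irrelevant_ideal_def
    using is_form_variable by (intro ideal_gen_minimal is_ideal_order_ge) (fastforce simp: order_ge_def is_form_def)
  then have "ideal_mult (irrelevant_ideal :: 'a poly3 set) (ideal_power irrelevant_ideal d) \<subseteq> order_ge (1 + d)"
    using Suc by (intro ideal_mult_subset is_ideal_order_ge order_ge_mult) auto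
  then show ?case by simp
qed (simp add: order_ge_def)

section \<open>Coordinates adapted to the conic\<close>

definition linear_form :: "'a::comm_ring_1 ^ 3 \<Rightarrow> 'a poly3" where
  "linear_form l = (\<Sum>i\<in>UNIV. const (l $ i) * variable i)"

lemma is_form_linear_form: "is_form 1 (linear_form l)"
  unfolding linear_form_def
  using is_form_mult[OF is_form_const is_form_variable] by (auto intro!: is_form_sum)

lemma subst_linear_form: "is_ring_hom h \<Longrightarrow> subst h f (linear_form l) = (\<Sum>i\<in>UNIV. h (l $ i) * f i)"
  by (simp add: linear_form_def ring_hom_simps[OF is_ring_hom_subst] subst_const subst_variable)

definition dot :: "'a::comm_ring_1 ^ 3 \<Rightarrow> 'a ^ 3 \<Rightarrow> 'a" where
  "dot l v = (\<Sum>i\<in>UNIV. l $ i * v $ i)"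

text \<open>A basis \<open>v\<close> and its dual basis \<open>l\<close>. The assumptions are the
  two orders of a matrix inverse: \<open>dual\<close> evaluates coordinates, \<open>expand\<close>
  recovers variables and vectors from them.\<close>

locale conic_frame =
  fixes v :: "nat \<Rightarrow> 'a::field ^ 3" and l :: "nat \<Rightarrow> 'a ^ 3"
  assumes dual: "\<And>i j. i < 3 \<Longrightarrow> j < 3 \<Longrightarrow> dot (l i) (v j) = (if i = j then 1 else 0)"
    and expand: "\<And>i j. (\<Sum>k<3. v k $ i * l k $ j) = (if i = j then 1 else 0)"
begin

definition x :: "'a poly3" where "x = linear_form (l 0)"
definition y :: "'a poly3" where "y = linear_form (l 1)"
definition z :: "'a poly3" where "z = linear_form (l 2)"

definition pt :: "'a \<Rightarrow> 'a ^ 3" where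
  "pt \<tau> = (\<chi> i. v 0 $ i + \<tau> * v 1 $ i + \<tau>\<^sup>2 * v 2 $ i)"

text \<open>Each variable goes to its value at \<open>v 0 + t v 1 + t ^ 2 v 2\<close> times the
  grading variable.\<close>

definition Phi :: "'a poly3 \<Rightarrow> 'a poly poly" where
  "Phi = subst (\<lambda>c. [:[:c:]:]) (\<lambda>i. [:0, [:v 0 $ i, v 1 $ i, v 2 $ i:]:])"

text \<open>Identity at \<open>\<epsilon> = 1\<close>, projection to the point at
  \<open>\<epsilon> = 0\<close>. The coefficient of \<open>\<epsilon>\<close> is a linear form
  vanishing at \<open>pt \<tau>\<close>, where \<open>x\<close> is 1.\<close>

definition psi :: "'a \<Rightarrow> 'a poly3 \<Rightarrow> 'a poly3 poly" where
  "psi \<tau> = subst (\<lambda>c. [:const c:]) (\<lambda>i. [:const (pt \<tau> $ i) * x, variable i - const (pt \<tau> $ i) * x:])"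

lemma dot_pt: "dot (l 0) (pt \<tau>) = 1" "dot (l 1) (pt \<tau>) = \<tau>" "dot (l 2) (pt \<tau>) = \<tau>\<^sup>2"
proof -
  have "dot (l j) (pt \<tau>) = dot (l j) (v 0) + \<tau> * dot (l j) (v 1) + \<tau>\<^sup>2 * dot (l j) (v 2)" for j
    by (simp add: dot_def pt_def sum_distrib_left sum.distrib algebra_simps)
  then show "dot (l 0) (pt \<tau>) = 1" "dot (l 1) (pt \<tau>) = \<tau>" "dot (l 2) (pt \<tau>) = \<tau>\<^sup>2"
    by (simp_all add: dual)
qed

lemma lessThan_3: "{..<3::nat} = {0, 1, 2}"
  by auto

lemma variable_eq: "variable i = const (v 0 $ i) * x + const (v 1 $ i) * y + const (v 2 $ i) * z"
proof -
  note c = ring_hom_simps[OF is_ring_hom_const]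
  have "const (v 0 $ i) * x + const (v 1 $ i) * y + const (v 2 $ i) * z =
      (\<Sum>k<3. const (v k $ i) * linear_form (l k))"
    by (simp add: x_def y_def z_def lessThan_3)
  also have "\<dots> = (\<Sum>j\<in>UNIV. const (\<Sum>k<3. v k $ i * l k $ j) * variable j)"
    unfolding linear_form_def sum_distrib_left
    by (subst sum.swap) (simp add: c sum_distrib_right mult.assoc)
  also have "\<dots> = (\<Sum>j\<in>UNIV. if i = j then variable j else 0)"
    by (intro sum.cong) (auto simp: expand c)
  finally show ?thesis by simp
qed

lemma expand_vector: "w = dot (l 0) w *s v 0 + dot (l 1) w *s v 1 + dot (l 2) w *s v 2"
proof -
  have "(\<Sum>k<3. dot (l k) w * v k $ i) = w $ i" for i
  proof -
    have "(\<Sum>k<3. dot (l k) w * v k $ i) = (\<Sum>j\<in>UNIV. (\<Sum>k<3. v k $ i * l k $ j) * w $ j)"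
      unfolding dot_def sum_distrib_right by (subst sum.swap) (simp add: ac_simps)
    also have "\<dots> = (\<Sum>j\<in>UNIV. if i = j then w $ j else 0)"
      by (intro sum.cong) (auto simp: expand)
    finally show ?thesis by simp
  qed
  then show ?thesis by (simp add: vec_eq_iff lessThan_3 add.assoc del: One_nat_def)
qed

lemma Phi_linear_form: "Phi (linear_form l') = [:0, [:dot l' (v 0), dot l' (v 1), dot l' (v 2):]:]"
proof -
  have "is_ring_hom (\<lambda>c::'a. [:[:c:]:])"
    by (rule is_ring_hom_comp[OF is_ring_hom_const_poly is_ring_hom_const_poly])
  then have "Phi (linear_form l') = (\<Sum>i\<in>UNIV. [:0, [:l' $ i * v 0 $ i, l' $ i * v 1 $ i, l' $ i * v 2 $ i:]:])"
    by (simp add: Phi_def subst_linear_form)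
  then show ?thesis by (simp add: dot_def sum_3)
qed

lemma hom_psi_const: "is_ring_hom (\<lambda>c::'a. [:const c:])"
  by (rule is_ring_hom_comp[OF is_ring_hom_const_poly is_ring_hom_const])

lemma psi_linear_form:
  "psi \<tau> (linear_form l') = [:const (dot l' (pt \<tau>)) * x, linear_form l' - const (dot l' (pt \<tau>)) * x:]"
proof -
  have "psi \<tau> (linear_form l') = (\<Sum>i\<in>UNIV. [:const (l' $ i * pt \<tau> $ i) * x,
      const (l' $ i) * variable i - const (l' $ i * pt \<tau> $ i) * x:])"
    by (simp add: psi_def subst_linear_form[OF hom_psi_const] ring_hom_simps[OF is_ring_hom_const]
        algebra_simps)
  then show ?thesis
    by (simp add: linear_form_def dot_def sum_3 ring_hom_simps[OF is_ring_hom_const] algebra_simps)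
qed

sublocale parametrized_conic const x y z Phi psi
proof
  show "F \<in> S" if "\<And>c. const c \<in> S" "x \<in> S" "y \<in> S" "z \<in> S"
      "\<And>a b. a \<in> S \<Longrightarrow> b \<in> S \<Longrightarrow> a + b \<in> S" "\<And>a b. a \<in> S \<Longrightarrow> b \<in> S \<Longrightarrow> a * b \<in> S" for S F
    by (rule poly3_generated) (auto simp: variable_eq that)
  have hom: "is_ring_hom (\<lambda>c::'a. [:[:c:]:])"
    by (rule is_ring_hom_comp[OF is_ring_hom_const_poly is_ring_hom_const_poly])
  show "is_ring_hom Phi" "is_ring_hom (psi \<tau>)" for \<tau>
    unfolding Phi_def psi_def by (intro is_ring_hom_subst hom hom_psi_const)+
  show "Phi (const c) = [:[:c:]:]" for c
    by (simp add: Phi_def subst_const[OF hom])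
  show "psi \<tau> (const c) = [:const c:]" for \<tau> c
    by (simp add: psi_def subst_const[OF hom_psi_const])
  show "Phi x = [:0, 1:]" "Phi y = [:0, [:0, 1:]:]" "Phi z = [:0, [:0, 0, 1:]:]"
    unfolding x_def y_def z_def Phi_linear_form by (simp_all add: dual one_pCons)
  show "psi \<tau> x = [:x:]" for \<tau>
    using psi_linear_form[of \<tau> "l 0"] by (simp add: dot_pt flip: x_def) (simp add: const_def)
  show "psi \<tau> y = [:const \<tau> * x, y - const \<tau> * x:]"
    "psi \<tau> z = [:const (\<tau>\<^sup>2) * x, z - const (\<tau>\<^sup>2) * x:]" for \<tau>
    using psi_linear_form[of \<tau> "l 1"] psi_linear_form[of \<tau> "l 2"]
    by (simp_all add: dot_pt del: One_nat_def flip: y_def z_def)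
qed (rule is_ring_hom_const)

text \<open>Every variable becomes a coordinate of \<open>pt \<tau>\<close> times \<open>x\<close>,
  and homogeneity collects these factors into \<open>x ^ d\<close>.\<close>

lemma ev_form:
  assumes "is_form d F" shows "ev \<tau> F = const (eval_poly3 F (pt \<tau>)) * x ^ d"
proof -
  have deg: "(\<Prod>i\<in>UNIV. (const (pt \<tau> $ i) * x) ^ Poly_Mapping.lookup e i) =
      const (\<Prod>i\<in>UNIV. (pt \<tau> $ i) ^ Poly_Mapping.lookup e i) * x ^ d"
    if "e \<in> Poly_Mapping.keys F" for e
  proof -
    have "monom_degree e = d" using assms that by (simp add: is_form_def)
    then have "(\<Prod>i\<in>UNIV. x ^ Poly_Mapping.lookup e i) = x ^ d"
      by (simp add: monom_degree_def flip: power_sum)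
    then show ?thesis
      by (simp add: power_mult_distrib prod.distrib ring_hom_simps[OF is_ring_hom_const])
  qed
  have "ev \<tau> F = (\<Sum>e\<in>Poly_Mapping.keys F. const (Poly_Mapping.lookup F e) *
      (\<Prod>i\<in>UNIV. (const (pt \<tau> $ i) * x) ^ Poly_Mapping.lookup e i))"
    by (simp add: ev_def psi_def subst_def ring_hom_simps[OF is_ring_hom_poly] poly_sum poly_prod)
  also have "\<dots> = const (eval_poly3 F (pt \<tau>)) * x ^ d"
    by (simp add: deg eval_poly3_def ring_hom_simps[OF is_ring_hom_const] sum_distrib_right mult.assoc)
  finally show ?thesis .
qed

lemma eval_linear_form: "eval_poly3 (linear_form l') w = dot l' w"
  by (simp add: eval_poly3_eq_subst subst_linear_form[OF is_ring_hom_id] dot_def)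

text \<open>A form vanishing at the point is killed by \<open>ev\<close>, hence lies in
  \<open>pt_ideal\<close>. Conversely the two generators of \<open>pt_ideal\<close> are linear forms
  vanishing on the span.\<close>

lemma point_ideal_pt: "point_ideal (vec.span {pt \<tau>}) = pt_ideal \<tau>"
proof
  have "F \<in> pt_ideal \<tau>" if "is_form d F" "vanishes_at F (vec.span {pt \<tau>})" for d F
    using that ev_form[of d F \<tau>]
    by (auto simp: in_pt_ideal_iff vanishes_at_def vec.span_base ring_hom_0[OF is_ring_hom_const])
  then show "point_ideal (vec.span {pt \<tau>}) \<subseteq> pt_ideal \<tau>"
    unfolding point_ideal_def by (intro ideal_gen_minimal is_ideal_pt_ideal) auto
  have gen: "linear_form l' - const c * x \<in> point_ideal (vec.span {pt \<tau>})"
    if "dot l' (pt \<tau>) = c" for l' c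
  proof -
    have eq: "linear_form l' - const c * x = linear_form (l' - c *s l 0)"
      by (simp add: x_def linear_form_def ring_hom_simps[OF is_ring_hom_const] sum_3 algebra_simps)
    have "dot (l' - c *s l 0) (k *s pt \<tau>) = k * (dot l' (pt \<tau>) - c * dot (l 0) (pt \<tau>))" for k
      by (simp add: dot_def sum_3 algebra_simps)
    then have "vanishes_at (linear_form (l' - c *s l 0)) (vec.span {pt \<tau>})"
      using that by (auto simp: vanishes_at_def vec.span_singleton eval_linear_form dot_pt)
    then show ?thesis
      unfolding eq point_ideal_def using is_form_linear_form by (intro ideal_gen_superset) auto
  qed
  show "pt_ideal \<tau> \<subseteq> point_ideal (vec.span {pt \<tau>})"
    unfolding pt_ideal_def
    using gen[OF dot_pt(2)] gen[OF dot_pt(3)]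
    by (intro ideal_gen_minimal)
       (simp_all add: point_ideal_def is_ideal_ideal_gen y_def z_def del: One_nat_def)
qed

lemma irrelevant_ideal_eq: "irrelevant_ideal = ideal_gen {x, y, z}"
proof
  have "variable i \<in> ideal_gen {x, y, z}" for i
    unfolding variable_eq[of i]
    by (intro ideal_add ideal_mult_left is_ideal_ideal_gen ideal_gen_superset) auto
  then show "irrelevant_ideal \<subseteq> ideal_gen {x, y, z}"
    unfolding irrelevant_ideal_def by (intro ideal_gen_minimal is_ideal_ideal_gen) auto
  have "linear_form l' \<in> irrelevant_ideal" for l' :: "'a ^ 3"
    unfolding linear_form_def irrelevant_ideal_def
    by (intro ideal_sum ideal_mult_left is_ideal_ideal_gen ideal_gen_superset) auto
  then show "ideal_gen {x, y, z} \<subseteq> irrelevant_ideal"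
    unfolding x_def y_def z_def
    by (intro ideal_gen_minimal) (auto simp: irrelevant_ideal_def is_ideal_ideal_gen)
qed

lemma is_form_Q: "is_form 2 Q"
proof -
  have "is_form (1 + 1) (x * z)" "is_form (1 + 1) (y * y)"
    unfolding x_def y_def z_def by (intro is_form_mult is_form_linear_form)+
  then have "is_form 2 (x * z + - (y * y))"
    unfolding one_add_one by (intro is_form_add is_form_uminus)
  then show ?thesis by (simp add: Q_def power2_eq_square)
qed

text \<open>The first coordinate of \<open>pt\<close> is always 1, which excludes rescaling, and the
  second is the parameter.\<close>

lemma inj_span_pt: "inj (\<lambda>\<tau>. vec.span {pt \<tau>})"
proof (rule injI)
  fix \<sigma> \<tau> assume "vec.span {pt \<sigma>} = vec.span {pt \<tau>}"
  then have "pt \<sigma> \<in> vec.span {pt \<tau>}" by (metis vec.span_base singletonI)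
  then obtain k where k: "pt \<sigma> = k *s pt \<tau>" by (auto simp: vec.span_singleton)
  have dot: "dot l' (k *s w) = k * dot l' w" for l' w :: "'a ^ 3"
    by (simp add: dot_def sum_3 algebra_simps)
  have "k = 1" using dot_pt(1)[of \<sigma>] dot_pt(1)[of \<tau>] k dot by simp
  then show "\<sigma> = \<tau>" using dot_pt(2)[of \<sigma>] dot_pt(2)[of \<tau>] k by simp
qed

end

section \<open>Normal form of a smooth conic\<close>

text \<open>Over a finite field, 1 plus the product of all \<open>X - c\<close> would have no
  root.\<close>

lemma infinite_UNIV_alg_closed: "infinite (UNIV :: 'a::alg_closed_field set)"
proof
  assume fin: "finite (UNIV :: 'a set)"
  define p where "p = (\<Prod>c\<in>(UNIV :: 'a set). [:- c, 1:]) + 1"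
  have deg: "degree (\<Prod>c\<in>(UNIV :: 'a set). [:- c, 1:]) = card (UNIV :: 'a set)"
    by (subst degree_prod_eq_sum_degree) auto
  moreover have "card (UNIV :: 'a set) > 0" using fin by (simp add: card_gt_0_iff)
  ultimately have "degree p > 0" unfolding p_def by (subst degree_add_eq_left) auto
  then obtain c where "poly p c = 0" using alg_closed_imp_poly_has_root by blast
  moreover have "poly (\<Prod>c\<in>(UNIV :: 'a set). [:- c, 1:]) c = 0"
    using fin by (auto simp: poly_prod)
  ultimately show False by (simp add: p_def)
qed

lemma exists_square_root:
  fixes c :: "'a::alg_closed_field" obtains s where "s\<^sup>2 = c"
proof -
  have "degree [:- c, 0, 1:] > 0" by simp
  then obtain s where "poly [:- c, 0, 1:] s = 0" using alg_closed_imp_poly_has_root by blast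
  then have "s\<^sup>2 = c" by (simp add: power2_eq_square)
  then show ?thesis by (rule that)
qed

lemma proj_plane_span:
  assumes "P \<in> proj_plane" obtains p where "p \<noteq> 0" "P = vec.span {p}"
proof -
  have P: "vec.subspace P" "vec.dim P = 1" using assms by (auto simp: proj_plane_def)
  obtain B where B: "vec.independent B" "vec.span B = P" "card B = 1"
    using vec.basis_subspace_exists[OF P(1)] P(2) by metis
  then obtain p where "B = {p}" by (auto simp: card_1_singleton_iff)
  then show ?thesis using B that vec.dependent_zero[of B] by auto
qed

lemma span_in_proj_plane: "p \<noteq> 0 \<Longrightarrow> vec.span {p :: 'a::field ^ 3} \<in> proj_plane"
  using vec.dim_span_eq_card_independent[of "{p}"] by (simp add: proj_plane_def vec.dependent_single)

lemma vec_span_scale: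
  assumes "(c::'a::field) \<noteq> 0" shows "vec.span {c *s p} = vec.span {p :: 'a ^ 3}"
proof -
  have "k *s p = (k / c) *s (c *s p)" for k using assms by (simp add: vec_eq_iff)
  moreover have "k *s (c *s p) = (k * c) *s p" for k by simp
  ultimately show ?thesis
    unfolding vec.span_singleton by (intro equalityI image_subsetI; metis rangeI)
qed

section \<open>Quadratic forms in arbitrary characteristic\<close>

lemma quadratic_form_homogeneous:
  assumes "is_form 2 F" shows "eval_poly3 F (c *s v) = c\<^sup>2 * eval_poly3 F v"
proof -
  have "(\<Prod>i\<in>UNIV. (c *s v) $ i ^ Poly_Mapping.lookup e i) = c\<^sup>2 * (\<Prod>i\<in>UNIV. v $ i ^ Poly_Mapping.lookup e i)"
    if "e \<in> Poly_Mapping.keys F" for e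
  proof -
    have "monom_degree e = 2" using assms that by (simp add: is_form_def)
    then have "(\<Prod>i\<in>UNIV. c ^ Poly_Mapping.lookup e i) = c\<^sup>2"
      by (simp add: monom_degree_def flip: power_sum)
    then show ?thesis by (simp add: power_mult_distrib prod.distrib)
  qed
  then show ?thesis by (simp add: eval_poly3_def sum_distrib_left ac_simps)
qed

lemma dot_add: "dot l (v + w) = dot l v + dot l w"
  and dot_diff: "dot l (v - w) = dot l v - dot l w"
  and dot_scale: "dot l (c *s v) = c * dot l v"
  by (simp_all add: dot_def sum_3 algebra_simps)

lemma quadratic_monomial_polarization:
  fixes v1 v2 v3 w1 w2 w3 :: "'a::comm_ring_1"
  assumes "a + b + d = (2::nat)"
  shows "(v1 + w1) ^ a * (v2 + w2) ^ b * (v3 + w3) ^ d =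
    v1 ^ a * v2 ^ b * v3 ^ d + w1 ^ a * w2 ^ b * w3 ^ d +
    (of_nat a * (v1 ^ (a - 1) * v2 ^ b * v3 ^ d) * w1 + of_nat b * (v1 ^ a * v2 ^ (b - 1) * v3 ^ d) * w2 +
     of_nat d * (v1 ^ a * v2 ^ b * v3 ^ (d - 1)) * w3)"
proof -
  have "a = 0 \<or> a = 1 \<or> a = 2" and "b = 0 \<or> b = 1 \<or> b = 2" and d: "d = 2 - a - b" and "a + b \<le> 2"
    using assms by auto
  then show ?thesis
    unfolding d by (elim disjE) (simp_all add: power2_eq_square algebra_simps)
qed

lemma prod_3: "(\<Prod>i\<in>(UNIV :: 3 set). f i) = f 1 * f 2 * (f 3 :: 'a::comm_monoid_mult)"
  unfolding UNIV_3 by (simp add: ac_simps)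

text \<open>Checked monomial by monomial, without dividing by 2. It turns the Jacobian criterion
  into a statement about the polar form.\<close>

lemma quadratic_form_polarization:
  assumes "is_form 2 F"
  shows "eval_poly3 F (v + w) =
    eval_poly3 F v + eval_poly3 F w + dot (\<chi> i. eval_poly3 (partial_deriv i F) v) w"
proof -
  define m where "m e v = (\<Prod>i\<in>UNIV. (v $ i) ^ Poly_Mapping.lookup e i)" for e and v :: "'a ^ 3"
  define c where "c = Poly_Mapping.lookup F"
  define t where "t i e = of_nat (Poly_Mapping.lookup e i) * m (e - Poly_Mapping.single i 1) v" for i e
  have eval: "eval_poly3 F v = (\<Sum>e\<in>Poly_Mapping.keys F. c e * m e v)" for v
    by (simp add: eval_poly3_def m_def c_def)
  have D: "eval_poly3 (partial_deriv i F) v = (\<Sum>e\<in>Poly_Mapping.keys F. c e * t i e)" for i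
    by (simp add: partial_deriv_def eval_poly3_eq_subst subst_sum[OF is_ring_hom_id]
        subst_single[OF is_ring_hom_id] m_def c_def t_def mult_ac)
  have mono: "m e (v + w) = m e v + m e w + (\<Sum>i\<in>UNIV. t i e * w $ i)"
    if "e \<in> Poly_Mapping.keys F" for e
  proof -
    define a b d where abd: "a = Poly_Mapping.lookup e 1" "b = Poly_Mapping.lookup e 2" "d = Poly_Mapping.lookup e 3"
    have m: "m e u = u $ 1 ^ a * u $ 2 ^ b * u $ 3 ^ d" for u
      by (simp only: m_def prod_3 abd)
    have lookup_pred: "Poly_Mapping.lookup (e - Poly_Mapping.single i 1) j =
        Poly_Mapping.lookup e j - (if i = j then 1 else 0)" for i j
      by (simp add: lookup_minus lookup_single when_def)
    have t: "t 1 e = of_nat a * (v $ 1 ^ (a - 1) * v $ 2 ^ b * v $ 3 ^ d)"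
      "t 2 e = of_nat b * (v $ 1 ^ a * v $ 2 ^ (b - 1) * v $ 3 ^ d)"
      "t 3 e = of_nat d * (v $ 1 ^ a * v $ 2 ^ b * v $ 3 ^ (d - 1))"
      unfolding t_def m_def prod_3 lookup_pred abd by simp_all
    have "a + b + d = 2"
      using assms that by (auto simp: is_form_def monom_degree_def sum_3 abd)
    then show ?thesis
      unfolding sum_3 m t vector_add_component by (rule quadratic_monomial_polarization)
  qed
  have "eval_poly3 F (v + w) = (\<Sum>e\<in>Poly_Mapping.keys F. c e * (m e v + m e w + (\<Sum>i\<in>UNIV. t i e * w $ i)))"
    unfolding eval by (intro sum.cong refl) (simp add: mono)
  also have "\<dots> = eval_poly3 F v + eval_poly3 F w + (\<Sum>e\<in>Poly_Mapping.keys F. \<Sum>i\<in>UNIV. c e * (t i e * w $ i))"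
    by (simp add: eval distrib_left sum.distrib sum_distrib_left)
  also have "(\<Sum>e\<in>Poly_Mapping.keys F. \<Sum>i\<in>UNIV. c e * (t i e * w $ i)) =
      dot (\<chi> i. eval_poly3 (partial_deriv i F) v) w"
    unfolding dot_def by (subst sum.swap) (simp add: D sum_distrib_right mult.assoc)
  finally show ?thesis .
qed

text \<open>The dual basis consists of the rows of the inverse of the matrix with columns
  \<open>f0\<close>, \<open>f1\<close>, \<open>f2\<close>; a left inverse of a square matrix is also
  a right inverse.\<close>

lemma matrix_from_columns_inverse:
  fixes f0 f1 f2 :: "'a::field ^ 3"
  assumes indep: "\<And>a b c. a *s f0 + b *s f1 + c *s f2 = 0 \<Longrightarrow> a = 0 \<and> b = 0 \<and> c = 0"
  obtains l where "conic_frame (\<lambda>k. if k = 0 then f0 else if k = 1 then f1 else f2) l"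
proof -
  define v where "v = (\<lambda>k::nat. if k = 0 then f0 else if k = 1 then f1 else f2)"
  define A :: "'a ^ 3 ^ 3" where "A = (\<chi> i j. if j = 1 then f0 $ i else if j = 2 then f1 $ i else f2 $ i)"
  have "A *v t = t $ 1 *s f0 + t $ 2 *s f1 + t $ 3 *s f2" for t
    by (simp add: vec_eq_iff matrix_vector_mult_def A_def sum_3 mult.commute)
  then have "t = 0" if "A *v t = 0" for t
    using indep[of "t $ 1" "t $ 2" "t $ 3"] that by (simp add: vec_eq_iff forall_3)
  then obtain B where BA: "B ** A = mat 1"
    using matrix_left_invertible_ker[of A] by metis
  then have AB: "A ** B = mat 1" by (simp add: matrix_left_right_inverse)
  define l where "l = (\<lambda>k::nat. if k = 0 then B $ 1 else if k = 1 then B $ 2 else B $ 3)"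
  have "conic_frame v l"
  proof
    have BA': "(\<Sum>k\<in>UNIV. B $ i $ k * A $ k $ j) = (if i = j then 1 else 0)" for i j
      using BA by (simp add: vec_eq_iff matrix_matrix_mult_def mat_def)
    show "dot (l i) (v j) = (if i = j then 1 else 0)" if "i < 3" "j < 3" for i j
    proof -
      have "i = 0 \<or> i = 1 \<or> i = 2" "j = 0 \<or> j = 1 \<or> j = 2" using that by auto
      then show ?thesis
        using BA'[of 1 1] BA'[of 1 2] BA'[of 1 3] BA'[of 2 1] BA'[of 2 2] BA'[of 2 3]
          BA'[of 3 1] BA'[of 3 2] BA'[of 3 3]
        by (elim disjE) (simp_all add: dot_def l_def v_def A_def)
    qed
    show "(\<Sum>k<3. v k $ i * l k $ j) = (if i = j then 1 else 0)" for i j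
    proof -
      have "(\<Sum>k\<in>UNIV. A $ i $ k * B $ k $ j) = (if i = j then 1 else 0)"
        using AB by (simp add: vec_eq_iff matrix_matrix_mult_def mat_def)
      then show ?thesis
        by (simp add: sum_3 A_def v_def l_def numeral_3_eq_3)
    qed
  qed
  then show ?thesis using that unfolding v_def by blast
qed

text \<open>The isotropic vector \<open>f0\<close> is completed to a hyperbolic pair
  \<open>f0\<close>, \<open>f2\<close>. A vector orthogonal to both is anisotropic by smoothness and
  is rescaled to \<open>f1\<close>.\<close>

lemma smooth_quadratic_normal_form:
  fixes q :: "'a::alg_closed_field ^ 3 \<Rightarrow> 'a" and D :: "'a ^ 3 \<Rightarrow> 'a ^ 3"
  assumes hom: "\<And>c v. q (c *s v) = c\<^sup>2 * q v"
    and polar: "\<And>v w. q (v + w) = q v + q w + dot (D v) w"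
    and smooth: "\<And>v. v \<noteq> 0 \<Longrightarrow> q v = 0 \<Longrightarrow> \<exists>w. dot (D v) w \<noteq> 0"
    and f0: "f0 \<noteq> 0" "q f0 = 0"
  obtains f1 f2 where "\<And>a b c. q (a *s f0 + b *s f1 + c *s f2) = a * c - b\<^sup>2"
    and "\<And>a b c. a *s f0 + b *s f1 + c *s f2 = 0 \<Longrightarrow> a = 0 \<and> b = 0 \<and> c = 0"
proof -
  define B where "B v w = dot (D v) w" for v w
  have B_eq: "B v w = q (v + w) - q v - q w" for v w
    by (simp add: B_def polar)
  have sym: "B v w = B w v" for v w
    by (simp add: B_eq add.commute)
  have right: "B v (a + b) = B v a + B v b" "B v (a - b) = B v a - B v b" "B v (c *s a) = c * B v a"
    for v a b c by (simp_all add: B_def dot_add dot_diff dot_scale)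
  have left: "B (a + b) v = B a v + B b v" "B (a - b) v = B a v - B b v" "B (c *s a) v = c * B a v"
    for v a b c by (simp_all add: sym[of _ v] right)
  have two: "v + v = (2::'a) *s v" for v :: "'a ^ 3"
    by (simp add: vec_eq_iff)
  have diag: "B v v = 2 * q v" for v
    by (simp add: B_eq two hom)
  have sum2: "q (v + w) = q v + q w + B v w" for v w
    by (simp add: B_def polar)
  have minus: "q (v - w) = q v + q w - B v w" for v w
    using sum2[of v "- 1 *s w"] hom[of "- 1" w] right(3)[of v "- 1" w] by simp
  obtain w where w: "B f0 w \<noteq> 0"
    using smooth[OF f0] by (auto simp: B_def)
  define w1 where "w1 = (1 / B f0 w) *s w"
  have w1: "B f0 w1 = 1" using w by (simp add: w1_def right)
  \<comment> \<open>Subtracting this multiple of the isotropic \<open>f0\<close> makes the vector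
    isotropic and keeps its pairing with \<open>f0\<close>.\<close>
  define f2 where "f2 = w1 - q w1 *s f0"
  have f2: "B f0 f2 = 1" "q f2 = 0"
    by (simp_all add: f2_def right diag minus hom w1 f0 sym[of w1])
  have "vec.span {f0, f2} \<noteq> UNIV"
  proof
    assume "vec.span {f0, f2} = UNIV"
    then have "vec.dim (UNIV :: ('a ^ 3) set) \<le> card {f0, f2}"
      by (intro vec.dim_le_card) auto
    also have "\<dots> \<le> 2" by (simp add: card_insert_if)
    finally show False by (simp add: card_cart_basis)
  qed
  then obtain u where u: "u \<notin> vec.span {f0, f2}" by auto
  \<comment> \<open>Projection away from the hyperbolic pair: the coefficients are swapped because
    \<open>f0\<close> pairs to 1 with \<open>f2\<close> and to 0 with itself.\<close>
  define u1 where "u1 = u - (B u f2 *s f0 + B u f0 *s f2)"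
  have u1: "B f0 u1 = 0" "B f2 u1 = 0"
    by (simp_all add: u1_def right diag f0 f2 sym[of f2 f0] sym[of f0 u] sym[of f2 u])
  have comb: "B u f2 *s f0 + B u f0 *s f2 \<in> vec.span {f0, f2}"
    by (intro vec.span_add vec.span_scale vec.span_base) auto
  have u1_nz: "u1 \<noteq> 0"
    using u comb by (auto simp: u1_def)
  have indep: "a = 0 \<and> b = 0 \<and> c = 0" if "a *s f0 + b *s u1 + c *s f2 = 0" for a b c
  proof -
    have "B f0 (a *s f0 + b *s u1 + c *s f2) = c" "B f2 (a *s f0 + b *s u1 + c *s f2) = a"
      by (simp_all add: right diag f0 f2 u1 sym[of f2 f0])
    moreover have "B f 0 = 0" for f by (simp add: B_def dot_def)
    ultimately have "c = 0" "a = 0" unfolding that by auto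
    with that u1_nz show ?thesis by simp
  qed
  \<comment> \<open>Otherwise \<open>u1\<close> would be a zero of \<open>q\<close> orthogonal to
    \<open>f0\<close>, \<open>f2\<close> and itself, hence to everything, against
    smoothness.\<close>
  have q_u1: "q u1 \<noteq> 0"
  proof
    assume "q u1 = 0"
    then obtain w where w: "B u1 w \<noteq> 0" using smooth[OF u1_nz] by (auto simp: B_def)
    obtain l where "conic_frame (\<lambda>k. if k = 0 then f0 else if k = 1 then u1 else f2) l"
      using matrix_from_columns_inverse[OF indep] by blast
    then interpret conic_frame "\<lambda>k. if k = 0 then f0 else if k = 1 then u1 else f2" l .
    have "B u1 w = B u1 (dot (l 0) w *s f0 + dot (l 1) w *s u1 + dot (l 2) w *s f2)"
      using expand_vector[of w] by simp
    also have "\<dots> = 0"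
      by (simp add: right diag \<open>q u1 = 0\<close> sym[of u1] u1)
    finally show False using w by simp
  qed
  obtain s where s: "s\<^sup>2 = - 1 / q u1" by (rule exists_square_root)
  define f1 where "f1 = s *s u1"
  have s_nz: "s \<noteq> 0" using s q_u1 by auto
  have f1: "B f0 f1 = 0" "B f2 f1 = 0" "q f1 = - 1"
    using q_u1 by (simp_all add: f1_def right u1 hom s)
  show ?thesis
  proof
    show "q (a *s f0 + b *s f1 + c *s f2) = a * c - b\<^sup>2" for a b c
      by (simp add: sum2 left right hom f0 f1 f2 sym[of f1 f2])
    show "a = 0 \<and> b = 0 \<and> c = 0" if "a *s f0 + b *s f1 + c *s f2 = 0" for a b c
    proof -
      have "a *s f0 + (b * s) *s u1 + c *s f2 = 0" using that by (simp add: f1_def)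
      then show ?thesis using indep[of a "b * s" c] s_nz by simp
    qed
  qed
qed

section \<open>Choice of coordinates for points on a smooth conic\<close>

lemma dot_axis: "dot l (axis i 1) = l $ i"
proof -
  have "dot l (axis i 1) = (\<Sum>j\<in>UNIV. if j = i then l $ j else 0)"
    unfolding dot_def by (intro sum.cong) (auto simp: axis_def)
  then show ?thesis by simp
qed

text \<open>One of the points serves as the isotropic vector of the normal form. A change of
  parameter then makes the first coordinate nonzero at all points of \<open>X\<close>.\<close>

lemma conic_frame_exists:
  fixes X C :: "('a::alg_closed_field ^ 3) set set"
  assumes C: "smooth_conic C" and X: "X \<subseteq> C" "finite X" "X \<noteq> {}"
  obtains v l T where "conic_frame v l" and "X = (\<lambda>\<tau>. vec.span {conic_frame.pt v \<tau>}) ` T"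
proof -
  obtain F where F: "is_form 2 F"
    and smooth: "\<And>P. P \<in> proj_plane \<Longrightarrow> vanishes_at F P \<Longrightarrow> \<exists>i. \<not> vanishes_at (partial_deriv i F) P"
    and C_eq: "C = {P \<in> proj_plane. vanishes_at F P}"
    using C unfolding smooth_conic_def by blast
  define q where "q = eval_poly3 F"
  define D where "D v = (\<chi> i. eval_poly3 (partial_deriv i F) v)" for v
  have hom: "q (c *s v) = c\<^sup>2 * q v" for c v
    unfolding q_def by (rule quadratic_form_homogeneous[OF F])
  have polar: "q (v + w) = q v + q w + dot (D v) w" for v w
    unfolding q_def D_def by (rule quadratic_form_polarization[OF F])
  \<comment> \<open>The polar form is symmetric, so the gradient is linear in the point. A partial
    derivative that is nonzero somewhere on a line is then nonzero at its chosen
    representative.\<close>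
  have D_scale: "D (c *s v) $ i = c * D v $ i" for c v i
  proof -
    have sym: "dot (D v) w = dot (D w) v" for v w
      using polar[of v w] polar[of w v] by (simp add: add.commute)
    have "D (c *s v) $ i = dot (D (axis i 1)) (c *s v)"
      using sym[of "c *s v" "axis i 1"] by (simp add: dot_axis)
    also have "\<dots> = c * D v $ i"
      using sym[of v "axis i 1"] by (simp add: dot_scale dot_axis)
    finally show ?thesis .
  qed
  have vanishes: "vanishes_at F (vec.span {v}) \<longleftrightarrow> q v = 0" for v
    using hom[of 1 v] by (auto simp: vanishes_at_def vec.span_singleton hom vec.span_base simp flip: q_def)
  have smooth': "\<exists>w. dot (D v) w \<noteq> 0" if v: "v \<noteq> 0" "q v = 0" for v
  proof -
    obtain i where "\<not> vanishes_at (partial_deriv i F) (vec.span {v})"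
      using smooth[OF span_in_proj_plane[OF v(1)]] v(2) vanishes by blast
    then obtain c where "D (c *s v) $ i \<noteq> 0"
      by (auto simp: vanishes_at_def vec.span_singleton D_def)
    then have i: "D v $ i \<noteq> 0" by (auto simp: D_scale)
    then show ?thesis by (intro exI[of _ "axis i 1"]) (simp add: dot_axis)
  qed
  have points: "\<exists>p. p \<noteq> 0 \<and> P = vec.span {p} \<and> q p = 0" if "P \<in> X" for P
  proof -
    have P: "P \<in> proj_plane" "vanishes_at F P" using that X C_eq by auto
    then show ?thesis by (metis proj_plane_span vanishes)
  qed
  obtain P0 where "P0 \<in> X" using X(3) by auto
  then obtain f0 where f0: "f0 \<noteq> 0" "q f0 = 0" using points by metis
  obtain f1 f2 where normal: "\<And>a b c. q (a *s f0 + b *s f1 + c *s f2) = a * c - b\<^sup>2"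
    and indep: "\<And>a b c. a *s f0 + b *s f1 + c *s f2 = 0 \<Longrightarrow> a = 0 \<and> b = 0 \<and> c = 0"
    using smooth_quadratic_normal_form[OF hom polar smooth' f0] by blast
  let ?v = "\<lambda>f0 f1 f2 (k::nat). if k = 0 then f0 else if k = 1 then f1 else f2"
  obtain l where frame: "conic_frame (?v f0 f1 f2) l"
    using matrix_from_columns_inverse[OF indep] by blast
  obtain p where p_nz: "\<And>P. P \<in> X \<Longrightarrow> p P \<noteq> 0" and span_p: "\<And>P. P \<in> X \<Longrightarrow> vec.span {p P} = P"
    and q_p: "\<And>P. P \<in> X \<Longrightarrow> q (p P) = 0"
    using points by metis
  define a where "a P = dot (l 0) (p P)" for P
  define b where "b P = dot (l 1) (p P)" for P
  define c where "c P = dot (l 2) (p P)" for P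
  have p_eq: "p P = a P *s f0 + b P *s f1 + c P *s f2" for P
    using conic_frame.expand_vector[OF frame, of "p P"] by (simp add: a_def b_def c_def)
  have ac: "a P * c P = (b P)\<^sup>2" if "P \<in> X" for P
    using q_p[OF that] normal[of "a P" "b P" "c P"] p_eq[of P] by simp
  \<comment> \<open>The value at \<open>s\<close> will be the first coordinate of \<open>P\<close>
    in the new frame, so \<open>s\<close> has to avoid the roots of these finitely many
    polynomials.\<close>
  have poly_nz: "[:a P, 2 * b P, c P:] \<noteq> 0" if "P \<in> X" for P
  proof
    assume "[:a P, 2 * b P, c P:] = 0"
    then have "a P = 0" "c P = 0" by simp_all
    moreover have "b P = 0" using ac[OF that] \<open>a P = 0\<close> by simp
    ultimately have "p P = 0" unfolding p_eq by simp
    with p_nz[OF that] show False by contradiction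
  qed
  have "finite (\<Union>P\<in>X. {s. poly [:a P, 2 * b P, c P:] s = 0})"
    by (rule finite_UN_I[OF X(2)]) (rule poly_roots_finite[OF poly_nz])
  from ex_new_if_finite[OF infinite_UNIV_alg_closed this]
  obtain s where "s \<notin> (\<Union>P\<in>X. {s. poly [:a P, 2 * b P, c P:] s = 0})"
    by (elim exE)
  then have s: "poly [:a P, 2 * b P, c P:] s \<noteq> 0" if "P \<in> X" for P
    using that by simp
  \<comment> \<open>the reparametrization \<open>t \<mapsto> t / (1 + s t)\<close> moves the point at infinity away from \<open>X\<close>\<close>
  define g1 where "g1 = f1 - (2 * s) *s f0"
  define g2 where "g2 = f2 - s *s f1 + s\<^sup>2 *s f0"
  have comb: "a *s f0 + b *s g1 + c *s g2 = (a - 2 * s * b + s\<^sup>2 * c) *s f0 + (b - s * c) *s f1 + c *s f2" for a b c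
    by (simp add: g1_def g2_def vec_eq_iff algebra_simps)
  have indep': "a = 0 \<and> b = 0 \<and> c = 0" if "a *s f0 + b *s g1 + c *s g2 = 0" for a b c
  proof -
    have "(a - 2 * s * b + s\<^sup>2 * c) *s f0 + (b - s * c) *s f1 + c *s f2 = 0"
      using that unfolding comb .
    from indep[OF this] show ?thesis by (elim conjE) simp
  qed
  obtain l' where frame': "conic_frame (?v f0 g1 g2) l'"
    using matrix_from_columns_inverse[OF indep'] by blast
  have pt: "conic_frame.pt (?v f0 g1 g2) \<tau> = f0 + \<tau> *s g1 + \<tau>\<^sup>2 *s g2" for \<tau>
    by (simp add: conic_frame.pt_def[OF frame'] vec_eq_iff)
  have "\<exists>\<tau>. P = vec.span {conic_frame.pt (?v f0 g1 g2) \<tau>}" if "P \<in> X" for P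
  proof -
    \<comment> \<open>The coordinates of \<open>P\<close> in the new frame are \<open>a'\<close>,
      \<open>b'\<close> and \<open>c P\<close>. They satisfy \<open>a' * c P = b'\<^sup>2\<close>
      with \<open>a' \<noteq> 0\<close>, so the parameter of \<open>P\<close> is
      \<open>b' / a'\<close>.\<close>
    define a' where "a' = a P + 2 * s * b P + s\<^sup>2 * c P"
    define b' where "b' = b P + s * c P"
    have a': "a' \<noteq> 0" using s[OF that] by (simp add: a'_def algebra_simps power2_eq_square)
    have "a' * c P = a P * c P + 2 * s * b P * c P + s\<^sup>2 * c P * c P"
      by (simp only: a'_def distrib_right)
    also have "\<dots> = b'\<^sup>2"
      unfolding ac[OF that] b'_def power2_sum power_mult_distrib by (simp add: power2_eq_square ac_simps)
    finally have c: "c P = a' * (b' / a')\<^sup>2" using a' by (simp add: field_simps power2_eq_square)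
    have "a' - 2 * s * b' + s\<^sup>2 * c P = a P" "b' - s * c P = b P"
      by (simp_all add: a'_def b'_def algebra_simps power2_eq_square)
    then have "p P = a' *s f0 + b' *s g1 + c P *s g2"
      by (simp only: comb p_eq)
    also have "\<dots> = a' *s (f0 + (b' / a') *s g1 + (b' / a')\<^sup>2 *s g2)"
      by (subst c) (use a' in \<open>simp add: vec_eq_iff algebra_simps\<close>)
    finally have "p P = a' *s conic_frame.pt (?v f0 g1 g2) (b' / a')"
      by (simp only: pt)
    then have "vec.span {p P} = vec.span {conic_frame.pt (?v f0 g1 g2) (b' / a')}"
      by (simp only: vec_span_scale[OF a'])
    then show ?thesis
      unfolding span_p[OF that] by (rule exI)
  qed
  then have "\<forall>P\<in>X. \<exists>\<tau>. P = vec.span {conic_frame.pt (?v f0 g1 g2) \<tau>}"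
    by (intro ballI)
  from bchoice[OF this] obtain t
    where t: "\<forall>P\<in>X. P = vec.span {conic_frame.pt (?v f0 g1 g2) (t P)}"
    by (elim exE)
  have "X = (\<lambda>P. P) ` X" by (rule image_ident[symmetric])
  also have "\<dots> = (\<lambda>P. vec.span {conic_frame.pt (?v f0 g1 g2) (t P)}) ` X"
    by (rule image_cong[OF refl bspec[OF t]])
  finally have "X = (\<lambda>\<tau>. vec.span {conic_frame.pt (?v f0 g1 g2) \<tau>}) ` (t ` X)"
    by (simp only: image_image)
  with frame' show ?thesis by (rule that)
qed

section \<open>Symbolic powers of points on a smooth conic\<close>

text \<open>Transfers the abstract containments to polynomials: \<open>pt_ideal\<close> is the ideal
  of the point and the adapted coordinates generate the irrelevant ideal.\<close>

lemma (in conic_frame)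
  fixes k :: nat
  assumes T: "finite T" "card T = 2 * k + 1" "k \<ge> 2"
    and X: "X = (\<lambda>\<tau>. vec.span {pt \<tau>}) ` T"
  shows symbolic_power_subset_mixed: "symbolic_power X m \<subseteq>
      ideal_mult (ideal_power irrelevant_ideal (m div 2)) (ideal_power (points_ideal X) (Suc m div 2))"
    and symbolic_power_subset_power: "symbolic_power X m \<subseteq> ideal_power (points_ideal X) (3 * m div 4)"
    and alpha_symbolic_power: "alpha (symbolic_power X m) = 2 * m"
    and alpha_points_ideal: "alpha (points_ideal X) = 2"
proof -
  interpret odd_points_on_conic const x y z Phi psi T k
    by unfold_locales (use T in auto)
  have sp: "symbolic_power X m = symb m" for m
    by (simp add: symbolic_power_def symb_def X point_ideal_pt)
  have pi: "points_ideal X = I"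
    by (simp add: points_ideal_def X point_ideal_pt)
  show "symbolic_power X m \<subseteq>
      ideal_mult (ideal_power irrelevant_ideal (m div 2)) (ideal_power (points_ideal X) (Suc m div 2))"
    unfolding sp pi irrelevant_ideal_eq by (rule symb_subset_mixed)
  show "symbolic_power X m \<subseteq> ideal_power (points_ideal X) (3 * m div 4)"
    unfolding sp pi by (rule symb_subset_I_power)
  \<comment> \<open>The degree is attained by \<open>Q ^ m\<close>; a smaller one is excluded by
    \<open>symb_subset_M_power\<close>.\<close>
  have alpha: "alpha (symb m) = 2 * m" for m
    unfolding alpha_def
  proof (rule Least_equality)
    show "\<exists>F\<in>symb m. F \<noteq> 0 \<and> is_form (2 * m) F"
      using Q_power_in_symb[of m] Q_nonzero is_form_power[OF is_form_Q, of m] by (intro bexI[of _ "Q ^ m"]) auto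
  next
    fix d assume "\<exists>F\<in>symb m. F \<noteq> 0 \<and> is_form d F"
    then obtain F where F: "F \<in> symb m" "F \<noteq> 0" "is_form d F" by blast
    have "F \<in> order_ge (2 * m)"
    proof -
      have "F \<in> ideal_power irrelevant_ideal (2 * m)"
        using F(1) symb_subset_M_power[of m] by (auto simp: irrelevant_ideal_eq)
      then show ?thesis using irrelevant_ideal_power_subset by blast
    qed
    moreover obtain e where "e \<in> Poly_Mapping.keys F" using F(2) by (metis keys_eq_empty ex_in_conv)
    ultimately show "2 * m \<le> d" using F(3) by (auto simp: order_ge_def is_form_def)
  qed
  then show "alpha (symbolic_power X m) = 2 * m" by (simp add: sp)
  show "alpha (points_ideal X) = 2"
    unfolding pi symb_1[symmetric] alpha by simp
qed

theorem mainTheorem7: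
  fixes X C :: "('a::alg_closed_field ^ 3) set set"
    and n :: nat
    and I M :: "'a poly3 set"
  assumes "n \<ge> 5" and "odd n"
    and "smooth_conic C"
    and "X \<subseteq> C" and "finite X" and "card X = n"
    and "I = points_ideal X"
    and "M = irrelevant_ideal"
  shows
    "(\<forall>r\<ge>1. symbolic_power X (2 * r) \<subseteq> ideal_mult (ideal_power M r) (ideal_power I r)) \<and>
     (\<forall>r\<ge>1. symbolic_power X (2 * r - 1) \<subseteq> ideal_power I r) \<and>
     (\<forall>m\<ge>1. \<forall>r\<ge>1. real m / real r \<ge> 2 * real (alpha I) / (real (alpha I) + 1) \<longrightarrow>
        symbolic_power X m \<subseteq> ideal_power I r) \<and>
     (\<forall>r\<ge>1. symbolic_power X (2 * r - 1)
        \<subseteq> ideal_mult (ideal_power M (r - 1)) (ideal_power I r)) \<and>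
     (\<forall>r\<ge>1. alpha (symbolic_power X (2 * r - 1)) \<ge> r * alpha I + r - 1) \<and>
     (\<forall>m\<ge>1. \<forall>r\<ge>1. (real (alpha (symbolic_power X m)) + 1) / (real m + 1)
        \<le> real (alpha (symbolic_power X r)) / real r)"
proof -
  have "X \<noteq> {}" using \<open>card X = n\<close> \<open>n \<ge> 5\<close> by auto
  then obtain v l T where frame: "conic_frame v l"
    and X: "X = (\<lambda>\<tau>. vec.span {conic_frame.pt v \<tau>}) ` T"
    using conic_frame_exists[OF \<open>smooth_conic C\<close> \<open>X \<subseteq> C\<close> \<open>finite X\<close>] by metis
  obtain k where k: "n = 2 * k + 1" using \<open>odd n\<close> by (elim oddE)
  \<comment> \<open>Distinct parameters give distinct points, so \<open>T\<close> has
    \<open>n\<close> elements.\<close>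
  have inj: "inj_on (\<lambda>\<tau>. vec.span {conic_frame.pt v \<tau>}) T"
    using conic_frame.inj_span_pt[OF frame] by (rule inj_on_subset) simp
  have T: "finite T" "card T = 2 * k + 1" "k \<ge> 2"
    using \<open>finite X\<close> \<open>card X = n\<close> \<open>n \<ge> 5\<close> inj unfolding X k
    by (auto simp: card_image finite_image_iff)
  note mixed = conic_frame.symbolic_power_subset_mixed[OF frame T X, folded assms(7,8)]
  note power = conic_frame.symbolic_power_subset_power[OF frame T X, folded assms(7)]
  note alpha = conic_frame.alpha_symbolic_power[OF frame T X]
    conic_frame.alpha_points_ideal[OF frame T X, folded assms(7)]
  have even: "symbolic_power X (2 * r) \<subseteq> ideal_mult (ideal_power M r) (ideal_power I r)" for r
    using mixed[of "2 * r"] by simp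
  have odd: "symbolic_power X (2 * r - 1) \<subseteq> ideal_mult (ideal_power M (r - 1)) (ideal_power I r)"
    if "r \<ge> 1" for r
  proof -
    have "(2 * r - 1) div 2 = r - 1" "Suc (2 * r - 1) div 2 = r" using that by auto
    then show ?thesis using mixed[of "2 * r - 1"] by simp
  qed
  have "symbolic_power X (2 * r - 1) \<subseteq> ideal_power I r" if "r \<ge> 1" for r
    using odd[OF that] ideal_mult_subset_right[OF is_ideal_ideal_power] by blast
  moreover have "symbolic_power X m \<subseteq> ideal_power I r"
    if "r \<ge> 1" "real m / real r \<ge> 2 * real (alpha I) / (real (alpha I) + 1)" for m r
  proof -
    \<comment> \<open>As \<open>alpha I = 2\<close>, the threshold for \<open>m / r\<close> is
      4/3.\<close>
    have "4 * real r \<le> 3 * real m"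
      using that by (simp add: alpha field_simps)
    then have "r \<le> 3 * m div 4" by linarith
    then show ?thesis using power[of m] ideal_power_antimono by blast
  qed
  \<comment> \<open>With both values of \<open>alpha\<close> known this reads
    \<open>4 * r - 2 \<ge> 3 * r - 1\<close>.\<close>
  moreover have "alpha (symbolic_power X (2 * r - 1)) \<ge> r * alpha I + r - 1" if "r \<ge> 1" for r
    using that by (simp add: alpha)
  \<comment> \<open>The left side is \<open>(2 * m + 1) / (m + 1)\<close> and the right side is
    2.\<close>
  moreover have "(real (alpha (symbolic_power X m)) + 1) / (real m + 1) \<le> real (alpha (symbolic_power X r)) / real r"
    if "r \<ge> 1" for m r
    using that by (simp add: alpha field_simps)
  ultimately show ?thesis using even odd by blast
qed

end
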